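(* Let $G$ and $H$ be nonbipartite connected graphs. Then $$pc(G\times H)\leq \min\{pc(H)(b(G)+o(G)),\ pc(G)(b(H)+o(H))\}.$$
   Context: In an edge-colored graph (adjacent edges may receive the same color), a path is a proper path if no two adjacent edges of the path have the same color. The proper connection number $pc(G)$ of a connected graph $G$ is the minimum number of colors in an edge-coloring of $G$ such that every two distinct vertices are joined by a proper path. The direct product $G\times H$ has vertex set $V(G)\times V(H)$, with $(g,h)$ adjacent to $(g',h')$ iff $gg'\in E(G)$ and $hh'\in E(H)$. A graph is odd-even proper connected (under an edge-coloring) if between every pair of (not necessarily different) vertices there exist a properly colored path of odd length and a properly colored path of even length; the odd-even proper connection number $oepc(G)$ is the smallest number of colors needed for this, and equals $\infty$ if no such coloring exists. For a graph $G$, let $O^G$ be the spanning subgraph whose edges are exactly the edges of $G$ lying on some odd cycle of $G$, and let $B^G$ be the spanning subgraph with edge set $E(G)\setminus E(O^G)$. Let $O^G_1,\dots,O^G_k$ and $B^G_1,\dots,B^G_\ell$ be the components of $O^G$ and $B^G$, respectively, having more than one vertex. Define $o(G)=\sum_{i=1}^k oepc(O^G_i)$ and $b(G)=\sum_{j=1}^{\ell} pc(B^G_j)$. *)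

theory Defs
  imports "Graph_Theory.Graph_Theory" "HOL-Library.Extended_Nat"
begin

text \<open>
  A finite simple undirected graph is a digraph satisfying the locale predicate \<^const>\<open>graph\<close>
  (finite, loopless, no parallel arcs, symmetric): an edge \<open>uv\<close> is the pair of opposite arcs
  between \<open>u\<close> and \<open>v\<close>. Edge colorings are functions of the end set \<open>{u, v}\<close>, so opposite arcs
  always have the same color.
\<close>

definition edge_of :: "('a, 'b) pre_digraph \<Rightarrow> 'b \<Rightarrow> 'a set" where
  "edge_of G e = {tail G e, head G e}"

definition bipartite :: "('a, 'b) pre_digraph \<Rightarrow> bool" where
  "bipartite G \<longleftrightarrow> (\<exists>X Y. X \<union> Y = verts G \<and> X \<inter> Y = {} \<and>
     (\<forall>e \<in> arcs G. (tail G e \<in> X \<and> head G e \<in> Y) \<or> (tail G e \<in> Y \<and> head G e \<in> X)))"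

definition direct_product ::
    "('a, 'b) pre_digraph \<Rightarrow> ('c, 'd) pre_digraph \<Rightarrow> ('a \<times> 'c, 'b \<times> 'd) pre_digraph" where
  "direct_product G H = \<lparr> verts = verts G \<times> verts H, arcs = arcs G \<times> arcs H,
     tail = map_prod (tail G) (tail H), head = map_prod (head G) (head H) \<rparr>"

lemma direct_product_adjacent:
  "(g, h) \<rightarrow>\<^bsub>direct_product G H\<^esub> (g', h') \<longleftrightarrow> g \<rightarrow>\<^bsub>G\<^esub> g' \<and> h \<rightarrow>\<^bsub>H\<^esub> h'"
  by (force simp: direct_product_def arcs_ends_conv)

lemma graph_direct_product:
  assumes "graph G" "graph H"
  shows "graph (direct_product G H)"
proof -
  interpret G: graph G by fact
  interpret H: graph H by fact
  have sym: "symmetric (direct_product G H)"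
    unfolding symmetric_def sym_def
    using G.sym_arcs H.sym_arcs
    by (auto simp: direct_product_adjacent symmetric_def dest: symD)
  show ?thesis
  proof unfold_locales
    show "symmetric (direct_product G H)" by (fact sym)
  qed (auto simp: direct_product_def arc_to_ends_def
         dest: G.no_loops intro: G.no_multi_arcs H.no_multi_arcs)
qed

definition k_edge_coloring :: "('a, 'b) pre_digraph \<Rightarrow> nat \<Rightarrow> ('a set \<Rightarrow> nat) \<Rightarrow> bool" where
  "k_edge_coloring G k c \<longleftrightarrow> (\<forall>e \<in> arcs G. c (edge_of G e) < k)"

definition properly_colored ::
    "('a, 'b) pre_digraph \<Rightarrow> ('a set \<Rightarrow> nat) \<Rightarrow> 'b awalk \<Rightarrow> bool" where
  "properly_colored G c p \<longleftrightarrow> distinct_adj (map (\<lambda>e. c (edge_of G e)) p)"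

definition proper_connected :: "('a, 'b) pre_digraph \<Rightarrow> ('a set \<Rightarrow> nat) \<Rightarrow> bool" where
  "proper_connected G c \<longleftrightarrow> (\<forall>u \<in> verts G. \<forall>v \<in> verts G. u \<noteq> v \<longrightarrow>
     (\<exists>p. pre_digraph.apath G u p v \<and> properly_colored G c p))"

definition pc :: "('a, 'b) pre_digraph \<Rightarrow> enat" where
  "pc G = Inf {enat k |k. \<exists>c. k_edge_coloring G k c \<and> proper_connected G c}"

text \<open>
  The library's \<^const>\<open>pre_digraph.cycle\<close> also admits the closed walk that traverses one edge
  back and forth; the length bound excludes it.
\<close>

definition graph_cycle :: "('a, 'b) pre_digraph \<Rightarrow> 'b awalk \<Rightarrow> bool" where
  "graph_cycle G p \<longleftrightarrow> pre_digraph.cycle G p \<and> 3 \<le> length p"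

text \<open>
  A path between \<open>u\<close> and \<open>v\<close> where \<open>u = v\<close> is allowed. The paths from \<open>u\<close> to itself are the
  trivial path of length 0 and the cycles through \<open>u\<close>, traversed starting at \<open>u\<close>. The adjacent
  edges of such a path are the consecutive ones: on a cycle, the first and last edge may share a
  color.
\<close>

definition path_or_cycle :: "('a, 'b) pre_digraph \<Rightarrow> 'a \<Rightarrow> 'b awalk \<Rightarrow> 'a \<Rightarrow> bool" where
  "path_or_cycle G u p v \<longleftrightarrow>
     pre_digraph.apath G u p v \<or> (u = v \<and> pre_digraph.awalk G u p u \<and> graph_cycle G p)"

definition odd_even_proper_connected :: "('a, 'b) pre_digraph \<Rightarrow> ('a set \<Rightarrow> nat) \<Rightarrow> bool" where
  "odd_even_proper_connected G c \<longleftrightarrow> (\<forall>u \<in> verts G. \<forall>v \<in> verts G.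
     (\<exists>p. path_or_cycle G u p v \<and> properly_colored G c p \<and> odd (length p)) \<and>
     (\<exists>p. path_or_cycle G u p v \<and> properly_colored G c p \<and> even (length p)))"

text \<open>The infimum of the empty set in \<^typ>\<open>enat\<close> is \<open>\<infinity>\<close>.\<close>

definition oepc :: "('a, 'b) pre_digraph \<Rightarrow> enat" where
  "oepc G = Inf {enat k |k. \<exists>c. k_edge_coloring G k c \<and> odd_even_proper_connected G c}"

definition odd_part :: "('a, 'b) pre_digraph \<Rightarrow> ('a, 'b) pre_digraph" where
  "odd_part G = G\<lparr>arcs := {e \<in> arcs G. \<exists>p. graph_cycle G p \<and> odd (length p) \<and> e \<in> set p}\<rparr>"

definition bip_part :: "('a, 'b) pre_digraph \<Rightarrow> ('a, 'b) pre_digraph" where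
  "bip_part G = G\<lparr>arcs := arcs G - arcs (odd_part G)\<rparr>"

definition nontrivial_components :: "('a, 'b) pre_digraph \<Rightarrow> ('a, 'b) pre_digraph set" where
  "nontrivial_components G =
     {C. pre_digraph.max_subgraph G connected C \<and> 1 < card (verts C)}"

definition o_sum :: "('a, 'b) pre_digraph \<Rightarrow> enat" where
  "o_sum G = (\<Sum>C \<in> nontrivial_components (odd_part G). oepc C)"

definition b_sum :: "('a, 'b) pre_digraph \<Rightarrow> enat" where
  "b_sum G = (\<Sum>C \<in> nontrivial_components (bip_part G). pc C)"

end

theory Submission
  imports Defs
begin

text \<open>
  Give the components of the odd and of the bipartite part of \<open>G\<close> disjoint palettes, color each
  optimally, and color an edge of the product by the pair of colors of its projections. Two
  components share at most one vertex, so a shortest chain of components between two vertices of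
  \<open>G\<close> yields a proper path, and every odd component on the chain allows its parity to be chosen.
  A chain without odd component is a single bipartite component; there the parity is corrected by a
  detour around an odd cycle of an adjacent odd component, and bipartiteness guarantees that no
  vertex is visited twice at the same parity. Hence any two vertices of \<open>G\<close> are joined, for either
  parity, by a properly colored walk \<open>W\<close> that lifts to a path in \<open>G \<times> K\<^sub>2\<close>. Pair it with a proper
  path \<open>P\<close> of \<open>H\<close> of the same parity, extending the shorter of the two by moving back and forth
  along an edge. If \<open>W\<close> is extended, then \<open>P\<close> makes the product walk a proper path; if \<open>P\<close> is
  extended, then equal vertices of \<open>P\<close> occur at equal parity and \<open>W\<close> does.
\<close>

subsection \<open>Walks as vertex lists\<close>

text \<open>A walk is kept as a start vertex and the list of its later vertices, so
  \<open>[]\<close> is the trivial walk, the length of the list counts edges, and a closed walk that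
  ends in its start vertex is a cycle as soon as the list is distinct and has at least three
  entries.\<close>

primrec walk_edges :: "'a \<Rightarrow> 'a list \<Rightarrow> 'a set list" where
  "walk_edges u [] = []"
| "walk_edges u (x # xs) = {u, x} # walk_edges x xs"

lemma length_walk_edges [simp]: "length (walk_edges u xs) = length xs"
  by (induction xs arbitrary: u) auto

lemma walk_edges_eq_Nil_iff [simp]: "walk_edges u xs = [] \<longleftrightarrow> xs = []"
  by (cases xs) auto

lemma walk_edges_append:
  "walk_edges u (xs @ ys) = walk_edges u xs @ walk_edges (last (u # xs)) ys"
  by (induction xs arbitrary: u) auto

lemma walk_edges_rev:
  "walk_edges (last (u # xs)) (rev (butlast (u # xs))) = rev (walk_edges u xs)"
  by (induction xs arbitrary: u) (auto simp: walk_edges_append insert_commute)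

lemma walk_edges_reverse:
  assumes "last (u # xs) = v"
  obtains ys where "last (v # ys) = u" "walk_edges v ys = rev (walk_edges u xs)"
    "length ys = length xs"
proof
  let ?ys = "rev (butlast (u # xs))"
  show "last (v # ?ys) = u" using assms by (cases xs) auto
  show "walk_edges v ?ys = rev (walk_edges u xs)" using walk_edges_rev[of u xs] assms by simp
  show "length ?ys = length xs" by simp
qed

lemma walk_vertices_subset:
  assumes "set (walk_edges u xs) \<subseteq> F" "u \<in> V" "\<And>e. e \<in> F \<Longrightarrow> e \<subseteq> V"
  shows "set (u # xs) \<subseteq> V"
  using assms(1,2)
proof (induction xs arbitrary: u)
  case (Cons x xs)
  then have "{u, x} \<subseteq> V" using assms(3) by auto
  with Cons show ?case by auto
qed simp

text \<open>Pairs each vertex with the parity of its position, so that the tagged list is the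
  corresponding walk in the direct product with a single edge.\<close>

primrec with_parity :: "bool \<Rightarrow> 'a list \<Rightarrow> ('a \<times> bool) list" where
  "with_parity b [] = []"
| "with_parity b (x # xs) = (x, b) # with_parity (\<not> b) xs"

lemma length_with_parity [simp]: "length (with_parity b xs) = length xs"
  by (induction xs arbitrary: b) auto

lemma map_fst_with_parity [simp]: "map fst (with_parity b xs) = xs"
  by (induction xs arbitrary: b) auto

lemma with_parity_append:
  "with_parity b (xs @ ys) = with_parity b xs @ with_parity (b = even (length xs)) ys"
proof (induction xs arbitrary: b)
  case (Cons x xs)
  then show ?case by (cases b) auto
qed simp

lemma distinct_with_parity: "distinct xs \<Longrightarrow> distinct (with_parity b xs)"
  by (metis distinct_map map_fst_with_parity)

lemma fst_with_parity: "(x, c) \<in> set (with_parity b xs) \<Longrightarrow> x \<in> set xs"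
  by (metis fst_conv image_eqI list.set_map map_fst_with_parity)

lemma with_parity_nth: "i < length xs \<Longrightarrow> with_parity b xs ! i = (xs ! i, b = even i)"
proof (induction xs arbitrary: b i)
  case (Cons x xs)
  then show ?case by (cases i) auto
qed simp

section \<open>Two-colorings of edge sets and odd closed walks\<close>

definition bicolors :: "('a \<Rightarrow> bool) \<Rightarrow> 'a set set \<Rightarrow> bool" where
  "bicolors s F \<longleftrightarrow> (\<forall>a b. {a, b} \<in> F \<longrightarrow> s a \<noteq> s b)"

text \<open>Every step of the walk flips the tag and the side of the bipartition at once, so whether
  the two agree is constant along the walk.\<close>

lemma bicolors_with_parity:
  assumes "bicolors s F" "set (walk_edges u xs) \<subseteq> F" "(v, c) \<in> set (with_parity b (u # xs))"
  shows "(c = b) = (s v = s u)"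
  using assms(2,3)
proof (induction xs arbitrary: u b)
  case (Cons x xs)
  have "s u \<noteq> s x" using Cons.prems(1) assms(1) by (auto simp: bicolors_def)
  moreover have "(c = (\<not> b)) = (s v = s x)" if "(v, c) \<in> set (with_parity (\<not> b) (x # xs))"
    using Cons.IH[OF _ that] Cons.prems(1) by auto
  ultimately show ?case using Cons.prems(2) by (auto split: if_splits)
qed auto

lemma bicolors_even_length:
  assumes "bicolors s F" "set (walk_edges u xs) \<subseteq> F"
  shows "even (length xs) = (s (last (u # xs)) = s u)"
  using assms(2)
proof (induction xs arbitrary: u)
  case (Cons x xs)
  have "s u \<noteq> s x" using Cons.prems(1) assms(1) by (auto simp: bicolors_def)
  with Cons show ?case by auto
qed auto

text \<open>A repeated vertex cuts the closed walk into two shorter closed walks whose lengths add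
  up to the original one, so one of them is again odd. Excluding loops rules out length 1 at the end
  of the descent.\<close>

lemma odd_closed_walk_imp_odd_cycle:
  assumes "\<And>v. {v} \<notin> F"
    and "set (walk_edges u xs) \<subseteq> F" "last (u # xs) = u" "odd (length xs)"
  shows "\<exists>v ys. set (walk_edges v ys) \<subseteq> F \<and> last (v # ys) = v \<and> odd (length ys) \<and>
    distinct ys \<and> 3 \<le> length ys"
  using assms(2-)
proof (induction "length xs" arbitrary: u xs rule: less_induct)
  case less
  show ?case
  proof (cases "distinct xs")
    case True
    have "length xs \<noteq> 1"
    proof
      assume "length xs = 1"
      then obtain x where "xs = [x]" by (auto simp: length_Suc_conv)
      with less.prems assms(1) show False by auto
    qed
    then have "3 \<le> length xs" using \<open>odd (length xs)\<close> by presburger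
    with True less.prems show ?thesis by blast
  next
    case False
    then obtain as bs cs y where xs: "xs = as @ [y] @ bs @ [y] @ cs"
      using not_distinct_decomp by blast
    have inner: "set (walk_edges y (bs @ [y])) \<subseteq> F"
      and outer: "set (walk_edges u (as @ [y] @ cs)) \<subseteq> F" "last (u # as @ [y] @ cs) = u"
      using less.prems(1,2) unfolding xs by (auto simp: walk_edges_append split: if_splits)
    have "odd (length (bs @ [y])) \<or> odd (length (as @ [y] @ cs))"
      using less.prems(3) unfolding xs by auto
    then show ?thesis
    proof
      assume "odd (length (bs @ [y]))"
      then show ?thesis using less.hyps[of "bs @ [y]" y] inner xs by auto
    next
      assume "odd (length (as @ [y] @ cs))"
      then show ?thesis using less.hyps[of "as @ [y] @ cs" u] outer xs by auto
    qed
  qed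
qed

text \<open>The side of a vertex records whether some walk of even length from the root
  \<open>r\<close> reaches it. If both ends of an edge were on the same side, an odd closed walk
  would arise or a walk could be extended to switch sides.\<close>

lemma bicolors_exists:
  assumes "\<And>u xs. set (walk_edges u xs) \<subseteq> F \<Longrightarrow> last (u # xs) = u \<Longrightarrow> even (length xs)"
    and reach: "\<And>a b. {a, b} \<in> F \<Longrightarrow> \<exists>xs. set (walk_edges r xs) \<subseteq> F \<and> last (r # xs) = a"
  shows "\<exists>s. bicolors s F"
proof -
  define s where "s v \<longleftrightarrow> (\<exists>xs. set (walk_edges r xs) \<subseteq> F \<and> last (r # xs) = v \<and> even (length xs))"
    for v
  have "s a \<noteq> s b" if ab: "{a, b} \<in> F" for a b
  proof
    assume eq: "s a = s b"
    obtain xs where xs: "set (walk_edges r xs) \<subseteq> F" "last (r # xs) = a"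
      using reach[OF ab] by blast
    show False
    proof (cases "s a")
      case False
      then have "odd (length xs)" using xs unfolding s_def by blast
      then have "s b" unfolding s_def
        using xs ab by (intro exI[of _ "xs @ [b]"]) (auto simp: walk_edges_append)
      with False eq show False by simp
    next
      case True
      then obtain as bs where as: "set (walk_edges r as) \<subseteq> F" "last (r # as) = a" "even (length as)"
        and bs: "set (walk_edges r bs) \<subseteq> F" "last (r # bs) = b" "even (length bs)"
        using eq unfolding s_def by blast
      obtain cs where cs: "last (b # cs) = r" "walk_edges b cs = rev (walk_edges r bs)"
        "length cs = length bs"
        using walk_edges_reverse[OF bs(2)] by blast
      \<comment> \<open>Two even walks from \<open>r\<close> to \<open>a\<close> and
        \<open>b\<close>, the second one reversed, are closed up by the edge between
        \<open>a\<close> and \<open>b\<close>; the total length is odd.\<close>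
      have "even (length (as @ [b] @ cs))"
      proof (rule assms(1))
        have "set (walk_edges b cs) \<subseteq> F" using cs(2) bs(1) by simp
        then show "set (walk_edges r (as @ [b] @ cs)) \<subseteq> F"
          using as ab by (auto simp: walk_edges_append)
        show "last (r # as @ [b] @ cs) = r" using cs(1) by auto
      qed
      then show False using as(3) bs(3) cs(3) by simp
    qed
  qed
  then show ?thesis unfolding bicolors_def by blast
qed

subsection \<open>Properly colored walks\<close>

text \<open>Repeated vertices are allowed on purpose: a walk in one factor may revisit vertices as
  long as its lift to the product does not, so distinctness is always stated separately.\<close>

definition proper_walk :: "('a set \<Rightarrow> 'c) \<Rightarrow> 'a set set \<Rightarrow> 'a \<Rightarrow> 'a list \<Rightarrow> 'a \<Rightarrow> bool" where
  "proper_walk c F u xs v \<longleftrightarrow> set (walk_edges u xs) \<subseteq> F \<and> last (u # xs) = v \<and>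
     distinct_adj (map c (walk_edges u xs))"

lemma proper_walk_Nil [simp]: "proper_walk c F u [] v \<longleftrightarrow> u = v"
  by (auto simp: proper_walk_def)

lemma proper_walk_mono: "proper_walk c F u xs v \<Longrightarrow> F \<subseteq> F' \<Longrightarrow> proper_walk c F' u xs v"
  by (auto simp: proper_walk_def)

text \<open>Properness only uses that adjacent colors differ, so it survives every coloring that
  still separates what the old one separated. This carries walks from a piece coloring to the
  combined one, and from the coloring of a factor to that of the product.\<close>

lemma proper_walk_recolor:
  assumes "proper_walk c F u xs v"
    and "\<And>e e'. e \<in> F \<Longrightarrow> e' \<in> F \<Longrightarrow> c e \<noteq> c e' \<Longrightarrow> c' e \<noteq> c' e'"
  shows "proper_walk c' F u xs v"
proof -
  have "distinct_adj (map c' es)" if "set es \<subseteq> F" "distinct_adj (map c es)" for es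
    using that
  proof (induction es)
    case (Cons e es)
    then show ?case using assms(2) by (cases es) auto
  qed simp
  then show ?thesis using assms(1) by (auto simp: proper_walk_def)
qed

lemma end_colors_in:
  assumes "set (walk_edges u xs) \<subseteq> F" "xs \<noteq> []"
  shows "hd (map c (walk_edges u xs)) \<in> c ` F" "last (map c (walk_edges u xs)) \<in> c ` F"
  using assms by (auto simp: hd_map last_map subset_iff)

lemma proper_walk_append:
  assumes "proper_walk c F u xs v" "proper_walk c F' v ys w" "c ` F \<inter> c ` F' = {}"
  shows "proper_walk c (F \<union> F') u (xs @ ys) w"
proof -
  let ?xs = "map c (walk_edges u xs)" and ?ys = "map c (walk_edges v ys)"
  have "last ?xs \<noteq> hd ?ys" if "xs \<noteq> []" "ys \<noteq> []"
    using end_colors_in[of u xs F c] end_colors_in[of v ys F' c] that assms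
    unfolding proper_walk_def by (metis disjoint_iff)
  then have "distinct_adj (?xs @ ?ys)"
    using assms(1,2) by (auto simp: distinct_adj_append_iff proper_walk_def)
  then show ?thesis using assms(1,2) by (auto simp: proper_walk_def walk_edges_append)
qed

text \<open>The two outer segments use the same palette, so a nonempty middle segment with foreign
  colors has to keep them apart.\<close>

lemma proper_walk_append3:
  assumes "proper_walk c F u xs v" "proper_walk c F' v ys v" "proper_walk c F v zs w"
    and "c ` F \<inter> c ` F' = {}" "ys \<noteq> []"
  shows "proper_walk c (F \<union> F') u (xs @ ys @ zs) w"
proof -
  let ?xs = "map c (walk_edges u xs)" and ?ys = "map c (walk_edges v ys)"
    and ?zs = "map c (walk_edges v zs)"
  have "last ?xs \<noteq> hd ?ys" if "xs \<noteq> []"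
    using end_colors_in[of u xs F c] end_colors_in[of v ys F' c] that assms
    unfolding proper_walk_def by (metis disjoint_iff)
  moreover have "last ?ys \<noteq> hd ?zs" if "zs \<noteq> []"
    using end_colors_in[of v zs F c] end_colors_in[of v ys F' c] that assms
    unfolding proper_walk_def by (metis disjoint_iff)
  ultimately have "distinct_adj (?xs @ ?ys @ ?zs)"
    using assms(1,2,3,5) by (auto simp: distinct_adj_append_iff proper_walk_def hd_append)
  then show ?thesis using assms(1,2,3,5) by (auto simp: proper_walk_def walk_edges_append)
qed

text \<open>Going around an odd cycle flips the parity, so the two outer segments may meet in a
  bipartite graph without repeating a vertex at the same parity.\<close>

lemma distinct_with_parity_detour:
  assumes s: "bicolors s F" and FV: "\<And>e. e \<in> F \<Longrightarrow> e \<subseteq> V" and xV: "x \<in> V"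
    and xs: "set (walk_edges u xs) \<subseteq> F" "last (u # xs) = x" "distinct (u # xs)"
    and ys: "last (x # ys) = x" "distinct ys" "odd (length ys)" "set ys \<inter> V \<subseteq> {x}"
    and zs: "set (walk_edges x zs) \<subseteq> F" "distinct (x # zs)"
  shows "distinct (with_parity True (u # xs @ ys @ zs))"
proof -
  have "ys \<noteq> []" using ys(3) by auto
  \<comment> \<open>The final return of the cycle to \<open>x\<close> is moved to the third segment,
    so that \<open>ys'\<close> is the interior of the cycle and avoids \<open>V\<close>.\<close>
  define ys' where "ys' = butlast ys"
  have ys': "ys = ys' @ [x]" using \<open>ys \<noteq> []\<close> ys(1) unfolding ys'_def
    by (metis append_butlast_last_id last_ConsR)
  have disj: "set ys' \<inter> V = {}" using ys ys' by auto
  have V3: "set (x # zs) \<subseteq> V" using walk_vertices_subset[OF zs(1) xV] FV by blast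
  have V1: "set (u # xs) \<subseteq> V"
  proof (cases xs)
    case Nil then show ?thesis using xs(2) xV by simp
  next
    case (Cons a as)
    then have "u \<in> V" using xs(1) FV[of "{u, a}"] by auto
    then show ?thesis using walk_vertices_subset[OF xs(1)] FV by blast
  qed
  \<comment> \<open>\<open>p\<close> is the tag of the position right after the first segment. The
    interior \<open>ys'\<close> has even length, so \<open>x\<close> reappears with tag
    \<open>p\<close>, opposite to its tag at the end of the first segment.\<close>
  define p where "p \<longleftrightarrow> even (length (u # xs))"
  have p: "p = (\<not> (s x = s u))" unfolding p_def using bicolors_even_length[OF s xs(1)] xs(2) by simp
  have split: "u # xs @ ys @ zs = (u # xs) @ ys' @ x # zs" using ys' by simp
  have "even (length ys')" using ys(3) ys' by simp
  then have eq: "with_parity True (u # xs @ ys @ zs) =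
      with_parity True (u # xs) @ with_parity p ys' @ with_parity p (x # zs)"
    unfolding split by (simp only: with_parity_append p_def simp_thms)
  \<comment> \<open>Within each outer segment the tag of a vertex is determined by its side, and the
    rule of the third segment is the opposite of the rule of the first.\<close>
  have "set (with_parity True (u # xs)) \<inter> set (with_parity p (x # zs)) = {}"
  proof (rule ccontr)
    assume "\<not> ?thesis"
    then obtain v b where 1: "(v, b) \<in> set (with_parity True (u # xs))"
      and 2: "(v, b) \<in> set (with_parity p (x # zs))" by (metis disjoint_iff surj_pair)
    from bicolors_with_parity[OF s xs(1) 1] bicolors_with_parity[OF s zs(1) 2] p
    show False by auto
  qed
  moreover have "set (with_parity True (u # xs)) \<inter> set (with_parity p ys') = {}"
    "set (with_parity p ys') \<inter> set (with_parity p (x # zs)) = {}"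
    using V1 V3 disj fst_with_parity by fast+
  moreover have "distinct (with_parity True (u # xs))" "distinct (with_parity p (x # zs))"
    "distinct (with_parity p ys')"
    using xs(3) zs(2) ys(2) ys' by (auto intro!: distinct_with_parity simp del: with_parity.simps)
  ultimately show ?thesis unfolding eq by (simp del: with_parity.simps) blast
qed

text \<open>Pieces satisfying \<open>odd_piece\<close> stand for components of the odd part, the others for components
  of the bipartite part.\<close>

locale piece_decomposition =
  fixes I :: "'i set" and V :: "'i \<Rightarrow> 'a set" and Ed :: "'i \<Rightarrow> 'a set set"
    and odd_piece :: "'i \<Rightarrow> bool" and k :: "'i \<Rightarrow> nat" and col :: "'i \<Rightarrow> 'a set \<Rightarrow> nat"
  assumes finite_I: "finite I"
    and Ed_subset: "C \<in> I \<Longrightarrow> e \<in> Ed C \<Longrightarrow> e \<subseteq> V C"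
    and Ed_pair: "C \<in> I \<Longrightarrow> e \<in> Ed C \<Longrightarrow> \<exists>a b. a \<noteq> b \<and> e = {a, b}"
    and share: "C \<in> I \<Longrightarrow> D \<in> I \<Longrightarrow> x \<in> V C \<inter> V D \<Longrightarrow> y \<in> V C \<inter> V D \<Longrightarrow> x \<noteq> y \<Longrightarrow> C = D"
    and share_bip: "C \<in> I \<Longrightarrow> D \<in> I \<Longrightarrow> \<not> odd_piece C \<Longrightarrow> \<not> odd_piece D \<Longrightarrow>
      x \<in> V C \<inter> V D \<Longrightarrow> C = D"
    and col_less: "C \<in> I \<Longrightarrow> e \<in> Ed C \<Longrightarrow> col C e < k C"
    and path: "C \<in> I \<Longrightarrow> u \<in> V C \<Longrightarrow> v \<in> V C \<Longrightarrow> u \<noteq> v \<Longrightarrow>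
      \<exists>xs. proper_walk (col C) (Ed C) u xs v \<and> distinct (u # xs) \<and>
        (odd_piece C \<longrightarrow> even (length xs) = b)"
    and odd_cycle: "C \<in> I \<Longrightarrow> odd_piece C \<Longrightarrow> u \<in> V C \<Longrightarrow>
      \<exists>xs. proper_walk (col C) (Ed C) u xs u \<and> distinct xs \<and> odd (length xs)"
    and bicolors: "C \<in> I \<Longrightarrow> \<not> odd_piece C \<Longrightarrow> \<exists>s. bicolors s (Ed C)"
    and attached: "C \<in> I \<Longrightarrow> \<not> odd_piece C \<Longrightarrow> \<exists>x D. x \<in> V C \<and> D \<in> I \<and> odd_piece D \<and> x \<in> V D"
    and connected: "u \<in> (\<Union>C\<in>I. V C) \<Longrightarrow> v \<in> (\<Union>C\<in>I. V C) \<Longrightarrow>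
      \<exists>xs. set (walk_edges u xs) \<subseteq> (\<Union>C\<in>I. Ed C) \<and> last (u # xs) = v"
begin

section \<open>Merging the piece colorings with disjoint palettes\<close>

definition combines :: "('a set \<Rightarrow> nat) \<Rightarrow> bool" where
  "combines c \<longleftrightarrow>
     (\<forall>C\<in>I. \<forall>e\<in>Ed C. \<forall>e'\<in>Ed C. col C e \<noteq> col C e' \<longrightarrow> c e \<noteq> c e') \<and>
     (\<forall>C\<in>I. \<forall>D\<in>I. C \<noteq> D \<longrightarrow> c ` Ed C \<inter> c ` Ed D = {})"

text \<open>An edge has two different ends, and distinct pieces share at most one vertex.\<close>

lemma Ed_inj:
  assumes "C \<in> I" "D \<in> I" "e \<in> Ed C" "e \<in> Ed D"
  shows "C = D"
proof -
  obtain a b where "a \<noteq> b" "e = {a, b}" using Ed_pair assms by blast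
  then show ?thesis using share[of C D a b] Ed_subset assms by auto
qed

text \<open>The palette is the disjoint union of the color sets of the pieces, numbered by a
  bijection \<open>f\<close>. The definite description in \<open>c\<close> is sound because
  \<open>Ed_inj\<close> makes the piece of an edge unique.\<close>

lemma combines_exists:
  "\<exists>c. combines c \<and> (\<forall>C\<in>I. \<forall>e\<in>Ed C. c e < (\<Sum>C\<in>I. k C))"
proof -
  define S where "S = (SIGMA C:I. {..<k C})"
  have "finite S" "card S = (\<Sum>C\<in>I. k C)"
    using finite_I by (auto simp: S_def)
  then obtain f where f: "bij_betw f S {0..<\<Sum>C\<in>I. k C}"
    using ex_bij_betw_finite_nat by metis
  define c where "c e = (let C = (THE C. C \<in> I \<and> e \<in> Ed C) in f (C, col C e))" for e
  have c: "c e = f (C, col C e)" "(C, col C e) \<in> S" if "C \<in> I" "e \<in> Ed C" for C e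
  proof -
    have "(THE C. C \<in> I \<and> e \<in> Ed C) = C" using that Ed_inj by blast
    then show "c e = f (C, col C e)" by (simp add: c_def)
    show "(C, col C e) \<in> S" using that col_less by (auto simp: S_def)
  qed
  have inj: "inj_on f S" and img: "f ` S = {0..<\<Sum>C\<in>I. k C}"
    using f by (auto simp: bij_betw_def)
  have "c e < (\<Sum>C\<in>I. k C)" if "C \<in> I" "e \<in> Ed C" for C e
    using c[OF that] img by (metis atLeastLessThan_iff imageI)
  moreover have "c e = c e' \<longleftrightarrow> C = D \<and> col C e = col D e'"
    if "C \<in> I" "e \<in> Ed C" "D \<in> I" "e' \<in> Ed D" for C D e e'
    using c[OF that(1,2)] c[OF that(3,4)] inj by (auto dest: inj_onD)
  ultimately show ?thesis unfolding combines_def by (intro exI[of _ c]) auto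
qed

section \<open>Chains of pieces between two vertices\<close>

fun weak_chain :: "'a \<Rightarrow> 'i list \<Rightarrow> 'a \<Rightarrow> bool" where
  "weak_chain u [] v \<longleftrightarrow> u = v"
| "weak_chain u (C # Cs) v \<longleftrightarrow> C \<in> I \<and> u \<in> V C \<and> (\<exists>a\<in>V C. weak_chain a Cs v)"

text \<open>These conditions are what concatenation needs: a piece meets the later ones at most in
  its exit vertex \<open>a\<close>, so paths through the pieces stay vertex-disjoint, and no piece
  recurs, so no palette recurs.\<close>

inductive chain :: "'a \<Rightarrow> 'i list \<Rightarrow> 'a \<Rightarrow> bool" where
  single: "C \<in> I \<Longrightarrow> u \<in> V C \<Longrightarrow> v \<in> V C \<Longrightarrow> u \<noteq> v \<Longrightarrow> chain u [C] v"
| step: "C \<in> I \<Longrightarrow> u \<in> V C \<Longrightarrow> a \<in> V C \<Longrightarrow> u \<noteq> a \<Longrightarrow> chain a Cs v \<Longrightarrow>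
    (\<And>D. D \<in> set Cs \<Longrightarrow> V C \<inter> V D \<subseteq> {a}) \<Longrightarrow> C \<notin> set Cs \<Longrightarrow> chain u (C # Cs) v"

lemma weak_chain_of_walk:
  assumes "set (walk_edges u xs) \<subseteq> (\<Union>C\<in>I. Ed C)" "last (u # xs) = v"
  shows "\<exists>Cs. weak_chain u Cs v"
  using assms
proof (induction xs arbitrary: u)
  case Nil
  then show ?case by (auto intro: exI[of _ "[]"])
next
  case (Cons x xs)
  then obtain Cs where "weak_chain x Cs v" by auto
  moreover obtain C where "C \<in> I" "{u, x} \<in> Ed C" using Cons.prems by auto
  moreover from this have "u \<in> V C" "x \<in> V C" using Ed_subset by auto
  ultimately have "weak_chain u (C # Cs) v" by auto
  then show ?case by blast
qed

lemma weak_chain_append: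
  "weak_chain u (As @ Bs) v \<longleftrightarrow> (\<exists>a. weak_chain u As a \<and> weak_chain a Bs v)"
  by (induction As arbitrary: u) auto

text \<open>Any meeting of the first piece with a later one is a shortcut. Minimality leaves only
  the meeting with the next piece, and two distinct pieces share just the vertex
  \<open>a\<close>.\<close>

lemma chain_of_shortest_weak_chain:
  assumes "weak_chain u Cs v" "u \<noteq> v" "\<And>Ds. weak_chain u Ds v \<Longrightarrow> length Cs \<le> length Ds"
  shows "chain u Cs v"
  using assms
proof (induction Cs arbitrary: u)
  case (Cons C Cs)
  from Cons.prems(1) obtain a where a: "C \<in> I" "u \<in> V C" "a \<in> V C" "weak_chain a Cs v" by auto
  have min: "length Cs \<le> length Ds" if "b \<in> V C" "weak_chain b Ds v" for b Ds
    using Cons.prems(3)[of "C # Ds"] a(1,2) that by auto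
  show ?case
  proof (cases "a = v")
    case True
    then have "Cs = []" using min[of a "[]"] a by simp
    then show ?thesis using a True Cons.prems(2) by (auto intro: single)
  next
    case False
    \<comment> \<open>Otherwise \<open>C\<close> could be dropped.\<close>
    have "u \<noteq> a" using Cons.prems(3)[of Cs] a by auto
    have Cs: "chain a Cs v" using Cons.IH[OF a(4) False] min a by blast
    \<comment> \<open>Leaving \<open>C\<close> at \<open>x\<close> directly into \<open>D\<close>
      skips the pieces \<open>As\<close>, so there are none; and if \<open>D\<close> were
      \<open>C\<close>, the tail \<open>Bs\<close> would already follow \<open>C\<close>.\<close>
    have hd: "\<exists>Bs. Cs = D # Bs \<and> C \<noteq> D" if Dx: "D \<in> set Cs" "x \<in> V C" "x \<in> V D" for D x
    proof -
      obtain As Bs where AB: "Cs = As @ D # Bs" using Dx(1) by (meson split_list)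
      then obtain b where b: "b \<in> V D" "weak_chain b Bs v" "D \<in> I"
        using a(4) by (auto simp: weak_chain_append)
      then have "weak_chain x (D # Bs) v" using that by auto
      then have "As = []" using min[of x "D # Bs"] that AB by simp
      moreover have "C \<noteq> D" using min[of b Bs] b AB by auto
      ultimately show ?thesis using AB by auto
    qed
    have "V C \<inter> V D \<subseteq> {a}" if D: "D \<in> set Cs" for D
    proof
      fix x assume x: "x \<in> V C \<inter> V D"
      then obtain Bs where "Cs = D # Bs" "C \<noteq> D" using hd D by blast
      then have "a \<in> V C \<inter> V D" "D \<in> I" using a by auto
      then show "x \<in> {a}" using share[of C D a x] a(1) x \<open>C \<noteq> D\<close> by auto
    qed
    moreover have "C \<notin> set Cs" using hd a(2) by blast
    ultimately show ?thesis using a \<open>u \<noteq> a\<close> Cs by (intro step[of C u a]) auto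
  qed
qed simp

lemma chain_exists:
  assumes "u \<in> (\<Union>C\<in>I. V C)" "v \<in> (\<Union>C\<in>I. V C)" "u \<noteq> v"
  shows "\<exists>Cs. chain u Cs v"
proof -
  have "\<exists>Cs. weak_chain u Cs v" using connected[OF assms(1,2)] weak_chain_of_walk by blast
  then obtain Cs where "weak_chain u Cs v" "\<And>Ds. weak_chain u Ds v \<Longrightarrow> length Cs \<le> length Ds"
    using ex_has_least_nat[of "\<lambda>Cs. weak_chain u Cs v" _ length] by blast
  then show ?thesis using chain_of_shortest_weak_chain assms(3) by blast
qed

lemma chain_properties:
  assumes "chain u Cs v"
  shows "set Cs \<subseteq> I" "Cs \<noteq> []" "u \<in> V (hd Cs)"
  using assms by (induction rule: chain.induct) auto

text \<open>Two consecutive bipartite pieces would share a vertex and hence coincide by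
  \<open>share_bip\<close>, but a chain does not repeat a piece.\<close>

lemma chain_without_odd_piece:
  assumes "chain u Cs v" "\<forall>C\<in>set Cs. \<not> odd_piece C"
  shows "\<exists>C. Cs = [C]"
  using assms
proof (cases rule: chain.cases)
  case (step C a Cs')
  have "hd Cs' \<in> set Cs'" "hd Cs' \<in> I" "a \<in> V (hd Cs')"
    using chain_properties[OF step(6)] by auto
  then have "C = hd Cs'" using share_bip[of C "hd Cs'" a] step assms(2) by auto
  with step \<open>hd Cs' \<in> set Cs'\<close> show ?thesis by simp
qed auto

text \<open>One odd piece is enough to choose the parity of the whole path. If the first piece is
  odd, it is adjusted to the rest; otherwise the rest is asked to compensate for the length forced
  in the first piece.\<close>

lemma chain_path:
  assumes c: "combines c" and "chain u Cs v"
  shows "\<exists>xs. proper_walk c (\<Union>C\<in>set Cs. Ed C) u xs v \<and> distinct (u # xs) \<and>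
    ((\<exists>C\<in>set Cs. odd_piece C) \<longrightarrow> even (length xs) = b)"
  using assms(2)
proof (induction arbitrary: b rule: chain.induct)
  case (single C u v)
  obtain xs where xs: "proper_walk (col C) (Ed C) u xs v" "distinct (u # xs)"
    "odd_piece C \<longrightarrow> even (length xs) = b"
    using path[OF single] by blast
  have "proper_walk c (Ed C) u xs v"
    using c single(1) by (intro proper_walk_recolor[OF xs(1)]) (auto simp: combines_def)
  then show ?case using xs by auto
next
  case (step C u a Cs v)
  have "\<exists>xs ys. proper_walk (col C) (Ed C) u xs a \<and> distinct (u # xs) \<and>
    proper_walk c (\<Union>C\<in>set Cs. Ed C) a ys v \<and> distinct (a # ys) \<and>
    ((\<exists>C\<in>set (C # Cs). odd_piece C) \<longrightarrow> even (length (xs @ ys)) = b)"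
  proof (cases "odd_piece C")
    case True
    obtain ys where ys: "proper_walk c (\<Union>C\<in>set Cs. Ed C) a ys v" "distinct (a # ys)"
      using step.IH by blast
    \<comment> \<open>The prescribed truth value is the parity that \<open>xs\<close> must have for
      \<open>xs @ ys\<close> to have parity \<open>b\<close>.\<close>
    obtain xs where "proper_walk (col C) (Ed C) u xs a" "distinct (u # xs)"
      "even (length xs) = (b = even (length ys))"
      using path[OF step(1-4), of "b = even (length ys)"] True by blast
    then show ?thesis using ys by (intro exI[of _ xs] exI[of _ ys]) auto
  next
    case False
    obtain xs where xs: "proper_walk (col C) (Ed C) u xs a" "distinct (u # xs)"
      using path[OF step(1-4)] by blast
    obtain ys where "proper_walk c (\<Union>C\<in>set Cs. Ed C) a ys v" "distinct (a # ys)"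
      "(\<exists>C\<in>set Cs. odd_piece C) \<longrightarrow> even (length ys) = (b = even (length xs))"
      using step.IH[of "b = even (length xs)"] by blast
    then show ?thesis using xs False by (intro exI[of _ xs] exI[of _ ys]) auto
  qed
  then obtain xs ys where xs: "proper_walk (col C) (Ed C) u xs a" "distinct (u # xs)"
    and ys: "proper_walk c (\<Union>C\<in>set Cs. Ed C) a ys v" "distinct (a # ys)"
    and par: "(\<exists>C\<in>set (C # Cs). odd_piece C) \<longrightarrow> even (length (xs @ ys)) = b" by blast
  have CsI: "set Cs \<subseteq> I" and "hd Cs \<in> set Cs" "a \<in> V (hd Cs)"
    using chain_properties[OF step(5)] by auto
  have xs': "proper_walk c (Ed C) u xs a"
    using c step(1) by (intro proper_walk_recolor[OF xs(1)]) (auto simp: combines_def)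
  have "c ` Ed C \<inter> c ` Ed D = {}" if "D \<in> set Cs" for D
  proof -
    have "D \<in> I" "C \<noteq> D" using that CsI step(7) by auto
    then show ?thesis using c step(1) by (simp add: combines_def)
  qed
  then have "c ` Ed C \<inter> c ` (\<Union>C\<in>set Cs. Ed C) = {}" by blast
  then have "proper_walk c (Ed C \<union> (\<Union>C\<in>set Cs. Ed C)) u (xs @ ys) v"
    by (rule proper_walk_append[OF xs' ys(1)])
  then have "proper_walk c (\<Union>C\<in>set (C # Cs). Ed C) u (xs @ ys) v" by simp
  moreover have uxs: "set (u # xs) \<subseteq> V C"
    using xs(1) step(1,2) Ed_subset by (intro walk_vertices_subset) (auto simp: proper_walk_def)
  moreover have ays: "set (a # ys) \<subseteq> (\<Union>D\<in>set Cs. V D)"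
  proof (rule walk_vertices_subset)
    show "set (walk_edges a ys) \<subseteq> (\<Union>C\<in>set Cs. Ed C)" using ys by (simp add: proper_walk_def)
    show "a \<in> (\<Union>D\<in>set Cs. V D)" using \<open>hd Cs \<in> set Cs\<close> \<open>a \<in> V (hd Cs)\<close> by blast
    show "e \<subseteq> (\<Union>D\<in>set Cs. V D)" if "e \<in> (\<Union>C\<in>set Cs. Ed C)" for e
      using that Ed_subset CsI by blast
  qed
  \<comment> \<open>The exit vertex \<open>a\<close> is the only possible common vertex, and it
    starts the second path, so it is not in \<open>ys\<close>.\<close>
  have "set (u # xs) \<inter> set ys \<subseteq> {a}" using uxs ays step(6) by fastforce
  then have "distinct ((u # xs) @ ys)" using xs(2) ys(2) by auto
  ultimately show ?case using par by auto
qed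

text \<open>Paths inside a bipartite piece all have one parity between given ends, so a path of
  parity \<open>b\<close> need not exist. Distinctness of the tagged vertices is weaker and admits a
  detour around an odd cycle, while still giving a path in the product.\<close>

lemma proper_walk_of_parity:
  assumes c: "combines c" and u: "u \<in> (\<Union>C\<in>I. V C)" and v: "v \<in> (\<Union>C\<in>I. V C)"
  shows "\<exists>xs. proper_walk c (\<Union>C\<in>I. Ed C) u xs v \<and> distinct (with_parity True (u # xs)) \<and>
    even (length xs) = b"
proof -
  have cycle: "\<exists>ys. proper_walk c (Ed C) x ys x \<and> distinct ys \<and> odd (length ys) \<and> set ys \<subseteq> V C"
    if C: "C \<in> I" "odd_piece C" "x \<in> V C" for C x
  proof -
    obtain ys where ys: "proper_walk (col C) (Ed C) x ys x" "distinct ys" "odd (length ys)"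
      using odd_cycle[OF C] by blast
    then have "set (x # ys) \<subseteq> V C"
      using C Ed_subset by (intro walk_vertices_subset) (auto simp: proper_walk_def)
    moreover have "proper_walk c (Ed C) x ys x"
      using c C(1) by (intro proper_walk_recolor[OF ys(1)]) (auto simp: combines_def)
    ultimately show ?thesis using ys by auto
  qed
  have path': "\<exists>xs. proper_walk c (Ed C) x xs y \<and> distinct (x # xs)"
    if C: "C \<in> I" "x \<in> V C" "y \<in> V C" for C x y
  proof (cases "x = y")
    case True then show ?thesis by (intro exI[of _ "[]"]) auto
  next
    case False
    obtain xs where xs: "proper_walk (col C) (Ed C) x xs y" "distinct (x # xs)"
      using path[OF C False] by blast
    moreover have "proper_walk c (Ed C) x xs y"
      using c C(1) by (intro proper_walk_recolor[OF xs(1)]) (auto simp: combines_def)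
    ultimately show ?thesis by blast
  qed
  have path_or_detour: ?thesis if C: "C \<in> I" "\<not> odd_piece C" "u \<in> V C" "v \<in> V C" for C
  proof -
    obtain s where s: "bicolors s (Ed C)" using bicolors C by blast
    obtain ps where ps: "proper_walk c (Ed C) u ps v" "distinct (u # ps)" using path' C by blast
    show ?thesis
    proof (cases "even (length ps) = b")
      case True
      have "proper_walk c (\<Union>C\<in>I. Ed C) u ps v" using ps(1) C(1) by (auto elim: proper_walk_mono)
      then show ?thesis using True ps(2) distinct_with_parity by blast
    next
      case False
      \<comment> \<open>The path \<open>ps\<close> has the wrong parity, so the walk is rerouted
        through a vertex \<open>x\<close> at which an odd piece \<open>D\<close> is
        attached.\<close>
      obtain x D where x: "x \<in> V C" "D \<in> I" "odd_piece D" "x \<in> V D" using attached C by blast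
      obtain xs where xs: "proper_walk c (Ed C) u xs x" "distinct (u # xs)" using path' C x by blast
      obtain zs where zs: "proper_walk c (Ed C) x zs v" "distinct (x # zs)" using path' C x by blast
      obtain ys where ys: "proper_walk c (Ed D) x ys x" "distinct ys" "odd (length ys)"
        "set ys \<subseteq> V D" using cycle x by blast
      have "C \<noteq> D" using C x by auto
      have "set ys \<inter> V C \<subseteq> {x}" using ys(4) share[of C D x] C(1) x \<open>C \<noteq> D\<close> by blast
      then have "distinct (with_parity True (u # xs @ ys @ zs))"
        using s xs ys zs x(1) C(1) Ed_subset
        by (intro distinct_with_parity_detour[where F = "Ed C" and V = "V C" and x = x])
          (auto simp: proper_walk_def)
      moreover have "c ` Ed C \<inter> c ` Ed D = {}"
        using c C(1) x(2) \<open>C \<noteq> D\<close> unfolding combines_def by blast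
      then have "proper_walk c (Ed C \<union> Ed D) u (xs @ ys @ zs) v"
        using xs ys zs by (intro proper_walk_append3) auto
      then have "proper_walk c (\<Union>C\<in>I. Ed C) u (xs @ ys @ zs) v"
        using C(1) x(2) by (auto elim: proper_walk_mono)
      \<comment> \<open>By bipartiteness \<open>xs\<close> and \<open>zs\<close> together have the
        parity of \<open>ps\<close>; the odd cycle \<open>ys\<close> flips it.\<close>
      moreover have "even (length (xs @ ys @ zs)) = b"
      proof -
        have "even (length xs) = (s x = s u)" "even (length zs) = (s v = s x)"
          "even (length ps) = (s v = s u)"
          using bicolors_even_length[OF s] xs zs ps by (auto simp: proper_walk_def)
        then show ?thesis using False ys(3) by auto
      qed
      ultimately show ?thesis by blast
    qed
  qed
  show ?thesis
  proof (cases "u = v")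
    case True
    obtain C where C: "C \<in> I" "u \<in> V C" using u by auto
    show ?thesis
    proof (cases "odd_piece C")
      case False
      then show ?thesis using path_or_detour C True by blast
    next
      case odd: True
      show ?thesis
      proof (cases b)
        case True
        then show ?thesis using \<open>u = v\<close> by (intro exI[of _ "[]"]) auto
      next
        case False
        obtain ys where ys: "proper_walk c (Ed C) u ys u" "distinct ys" "odd (length ys)"
          using cycle C odd by blast
        \<comment> \<open>An odd cycle at \<open>u\<close> is a detour with empty outer segments:
          only \<open>u\<close> is repeated, and at opposite parities.\<close>
        have "distinct (with_parity True (u # [] @ ys @ []))"
          by (rule distinct_with_parity_detour[where F = "{}" and V = "{u}"])
            (use ys in \<open>auto simp: bicolors_def proper_walk_def\<close>)
        moreover have "proper_walk c (\<Union>C\<in>I. Ed C) u ys v"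
          using ys(1) C(1) True by (auto elim: proper_walk_mono)
        ultimately show ?thesis using False ys(3) by (intro exI[of _ ys]) auto
      qed
    qed
  next
    case False
    then obtain Cs where Cs: "chain u Cs v" using chain_exists u v by blast
    show ?thesis
    proof (cases "\<exists>C\<in>set Cs. odd_piece C")
      case True
      obtain xs where "proper_walk c (\<Union>C\<in>set Cs. Ed C) u xs v" "distinct (u # xs)"
        "even (length xs) = b"
        using chain_path[OF c Cs] True by blast
      moreover have "set Cs \<subseteq> I" using chain_properties[OF Cs] by auto
      moreover from this have "(\<Union>C\<in>set Cs. Ed C) \<subseteq> (\<Union>C\<in>I. Ed C)" by blast
      ultimately show ?thesis by (metis proper_walk_mono distinct_with_parity)
    next
      case False
      then obtain C where C: "Cs = [C]" "\<not> odd_piece C" using chain_without_odd_piece[OF Cs] by auto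
      then have "C \<in> I" "u \<in> V C" "v \<in> V C" using Cs by (auto elim: chain.cases)
      then show ?thesis using path_or_detour C by blast
    qed
  qed
qed

end

subsection \<open>Proper paths in the direct product\<close>

text \<open>The start vertex of a path lies on no later edge, so its side can be chosen
  last.\<close>

lemma bicolors_path:
  assumes "distinct (u # xs)"
  shows "\<exists>s. bicolors s (set (walk_edges u xs))"
  using assms
proof (induction xs arbitrary: u)
  case Nil
  then show ?case by (simp add: bicolors_def)
next
  case (Cons x xs)
  then obtain s where s: "bicolors s (set (walk_edges x xs))" by auto
  have "e \<subseteq> set (x # xs)" if "e \<in> set (walk_edges x xs)" for e
    using that by (induction xs arbitrary: x) auto
  then have "u \<notin> e" if "e \<in> set (walk_edges x xs)" for e
    using that Cons.prems by auto
  then have "bicolors (s(u := \<not> s x)) (set (walk_edges u (x # xs)))"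
    using s Cons.prems by (fastforce simp: bicolors_def doubleton_eq_iff)
  then show ?case by blast
qed

text \<open>The last edge is traversed back and forth. No new edge is used, so a bipartition of the
  edges of the old walk also fits the padded one.\<close>

lemma pad_walk:
  assumes "xs \<noteq> []"
  shows "\<exists>ys. set (walk_edges u ys) \<subseteq> set (walk_edges u xs) \<and> last (u # ys) = last (u # xs) \<and>
    length ys = length xs + 2 * m"
proof (induction m)
  case 0
  then show ?case by auto
next
  case (Suc m)
  then obtain ys where ys: "set (walk_edges u ys) \<subseteq> set (walk_edges u xs)"
    "last (u # ys) = last (u # xs)" "length ys = length xs + 2 * m" by blast
  then have "ys \<noteq> []" using assms by auto
  then obtain zs b where zs: "ys = zs @ [b]" by (metis append_butlast_last_id)
  then have "{last (u # zs), b} \<in> set (walk_edges u xs)"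
    using ys(1) by (simp add: walk_edges_append)
  then have "set (walk_edges u (zs @ [b, last (u # zs), b])) \<subseteq> set (walk_edges u xs)"
    using ys(1) zs by (auto simp: walk_edges_append insert_commute)
  then show ?case using ys(2,3) zs
    by (intro exI[of _ "zs @ [b, last (u # zs), b]"]) auto
qed

text \<open>A nontrivial path is padded along its own last edge and keeps its bipartition. A trivial
  path has no edge of its own, and the edge to \<open>y\<close> takes over.\<close>

lemma pad_path:
  assumes "distinct (u # xs)" "set (walk_edges u xs) \<subseteq> F" "{u, y} \<in> F" "u \<noteq> y"
  shows "\<exists>ys s. set (walk_edges u ys) \<subseteq> F \<and> last (u # ys) = last (u # xs) \<and>
    length ys = length xs + 2 * m \<and> bicolors s (set (walk_edges u ys))"
proof -
  have mono: "bicolors s B" if "bicolors s A" "B \<subseteq> A" for s and A B :: "'a set set"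
    using that by (auto simp: bicolors_def)
  consider "xs \<noteq> []" | "xs = []" "m = 0" | n where "xs = []" "m = Suc n" by (cases m) auto
  then show ?thesis
  proof cases
    case 1
    then show ?thesis
      using pad_walk[OF 1, of u m] bicolors_path[OF assms(1)] assms(2) by (metis mono subset_trans)
  next
    case 2
    then show ?thesis by (intro exI[of _ "[]"]) (auto simp: bicolors_def)
  next
    case (3 n)
    \<comment> \<open>The closed walk \<open>[y, u]\<close> already accounts for two steps, so only
      \<open>n\<close> further rounds are added.\<close>
    obtain ys where ys: "set (walk_edges u ys) \<subseteq> {{u, y}}" "last (u # ys) = u"
      "length ys = 2 + 2 * n"
      using pad_walk[of "[y, u]" u n] by (auto simp: insert_commute)
    have "bicolors (\<lambda>x. x = u) {{u, y}}"
      using assms(4) by (auto simp: bicolors_def doubleton_eq_iff)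
    then have "bicolors (\<lambda>x. x = u) (set (walk_edges u ys))" using ys(1) mono by blast
    moreover have "set (walk_edges u ys) \<subseteq> F" using ys(1) assms(3) by auto
    ultimately show ?thesis using ys 3 by (intro exI[of _ ys] exI[of _ "\<lambda>x. x = u"]) auto
  qed
qed

section \<open>Edges and colors of the direct product\<close>

definition product_edges :: "'a set set \<Rightarrow> 'b set set \<Rightarrow> ('a \<times> 'b) set set" where
  "product_edges E F = {{(a, x), (b, y)} |a b x y. {a, b} \<in> E \<and> {x, y} \<in> F}"

lemma product_edgesI: "{a, b} \<in> E \<Longrightarrow> {x, y} \<in> F \<Longrightarrow> {(a, x), (b, y)} \<in> product_edges E F"
  unfolding product_edges_def by blast

lemma walk_edges_zip_subset:
  assumes "length xs = length ys" "set (walk_edges u xs) \<subseteq> E" "set (walk_edges h ys) \<subseteq> F"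
  shows "set (walk_edges (u, h) (zip xs ys)) \<subseteq> product_edges E F"
  using assms
  by (induction xs ys arbitrary: u h rule: list_induct2) (simp_all add: product_edgesI)

lemma
  assumes "length xs = length ys"
  shows last_zip_walk: "last ((u, h) # zip xs ys) = (last (u # xs), last (h # ys))"
    and map_fst_walk_edges_zip:
      "map (\<lambda>e. c (fst ` e)) (walk_edges (u, h) (zip xs ys)) = map c (walk_edges u xs)"
    and map_snd_walk_edges_zip:
      "map (\<lambda>e. c' (snd ` e)) (walk_edges (u, h) (zip xs ys)) = map c' (walk_edges h ys)"
  using assms by (induction xs ys arbitrary: u h rule: list_induct2) auto

text \<open>The pair of colors of the two projections, written as a two-digit number with last digit
  in base \<open>k\<close>; this is faithful as long as \<open>c'\<close> stays below
  \<open>k\<close>.\<close>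

definition product_coloring ::
    "('a set \<Rightarrow> nat) \<Rightarrow> ('b set \<Rightarrow> nat) \<Rightarrow> nat \<Rightarrow> ('a \<times> 'b) set \<Rightarrow> nat" where
  "product_coloring c c' k e = c (fst ` e) * k + c' (snd ` e)"

lemma product_coloring_eq_iff:
  assumes "c' (snd ` e) < k" "c' (snd ` f) < k"
  shows "product_coloring c c' k e = product_coloring c c' k f \<longleftrightarrow>
    c (fst ` e) = c (fst ` f) \<and> c' (snd ` e) = c' (snd ` f)"
proof
  assume eq: "product_coloring c c' k e = product_coloring c c' k f"
  have "product_coloring c c' k e mod k = c' (snd ` e)" "product_coloring c c' k f mod k = c' (snd ` f)"
    "product_coloring c c' k e div k = c (fst ` e)" "product_coloring c c' k f div k = c (fst ` f)"
    using assms by (auto simp: product_coloring_def)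
  then show "c (fst ` e) = c (fst ` f) \<and> c' (snd ` e) = c' (snd ` f)" using eq by simp
qed (simp add: product_coloring_def)

text \<open>The bipartition \<open>s\<close> makes the second coordinate determine the parity of the
  position. Equal pairs therefore carry equal tags in the first coordinate, where tagged vertices
  are distinct.\<close>

lemma distinct_zip_of_parity:
  assumes "distinct (with_parity True (u # xs))" "bicolors s (set (walk_edges h ys))"
    and "length xs = length ys"
  shows "distinct ((u, h) # zip xs ys)"
proof -
  let ?u = "u # xs" and ?h = "h # ys"
  have par: "(s (?h ! i) = s h) = even i" if "i < length ?h" for i
  proof -
    have "(?h ! i, True = even i) \<in> set (with_parity True ?h)"
      using that with_parity_nth[of i ?h True] by (metis length_with_parity nth_mem)
    from bicolors_with_parity[OF assms(2) order.refl this] show ?thesis by auto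
  qed
  have "distinct (zip ?u ?h)"
    unfolding distinct_conv_nth
  proof (intro allI impI notI)
    fix i j assume ij: "i < length (zip ?u ?h)" "j < length (zip ?u ?h)" "i \<noteq> j"
      "zip ?u ?h ! i = zip ?u ?h ! j"
    then have lt: "i < length ?u" "j < length ?u" "i < length ?h" "j < length ?h"
      using assms(3) by auto
    then have eq: "?u ! i = ?u ! j" "?h ! i = ?h ! j" using ij(4) nth_zip by (metis prod.inject)+
    then have "even i = even j" using par lt by metis
    then have "with_parity True ?u ! i = with_parity True ?u ! j"
      using eq lt by (simp only: with_parity_nth)
    then show False using assms(1) ij(3) lt by (metis length_with_parity nth_eq_iff_index_eq)
  qed
  then show ?thesis by simp
qed

text \<open>The walk that is not padded supplies both the color changes and the distinctness; the
  padded one may repeat colors and vertices. The edges at \<open>v\<close> and \<open>h\<close>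
  serve to pad a trivial walk.\<close>

lemma product_path:
  assumes nb: "{v, y} \<in> E" "v \<noteq> y" "{h, z} \<in> F" "h \<noteq> z"
    and xs: "proper_walk c E u xs v" "distinct (with_parity True (u # xs))"
    and ys: "proper_walk c' F h ys h'" "distinct (h # ys)"
    and par: "even (length xs) = even (length ys)"
    and k: "\<And>e. e \<in> F \<Longrightarrow> c' e < k"
  shows "\<exists>zs. proper_walk (product_coloring c c' k) (product_edges E F) (u, h) zs (v, h') \<and>
    distinct ((u, h) # zs)"
proof -
  have k': "c' (snd ` e) < k" if "e \<in> product_edges E F" for e
    using that k by (auto simp: product_edges_def)
  show ?thesis
  proof (cases "length ys \<le> length xs")
    case True
    then have "even (length xs - length ys)" using par by auto
    then obtain m where m: "length xs = length ys + 2 * m"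
      using True by (metis add_diff_inverse_nat dvdE not_le)
    obtain ws s where ws: "set (walk_edges h ws) \<subseteq> F" "last (h # ws) = h'" "length ws = length xs"
      "bicolors s (set (walk_edges h ws))"
      using pad_path[OF ys(2) _ nb(3,4), of m] ys(1) m unfolding proper_walk_def by metis
    have "proper_walk (\<lambda>e. c (fst ` e)) (product_edges E F) (u, h) (zip xs ws) (v, h')"
      using walk_edges_zip_subset[of xs ws u E h F] last_zip_walk[of xs ws u h]
        map_fst_walk_edges_zip[of xs ws c u h] xs(1) ws(1-3)
      by (simp add: proper_walk_def)
    then have "proper_walk (product_coloring c c' k) (product_edges E F) (u, h) (zip xs ws) (v, h')"
      by (rule proper_walk_recolor) (simp add: product_coloring_eq_iff k')
    then show ?thesis using distinct_zip_of_parity[OF xs(2) ws(4) ws(3)[symmetric]] by blast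
  next
    case False
    then have "even (length ys - length xs)" using par by auto
    then obtain m where m: "length ys = length xs + 2 * m"
      using False by (metis add_diff_inverse_nat dvdE nat_le_linear not_le)
    have "\<exists>ws. set (walk_edges u ws) \<subseteq> E \<and> last (u # ws) = v \<and> length ws = length ys"
    proof (cases "xs = []")
      case True
      then have "u = v" using xs(1) by simp
      \<comment> \<open>An empty \<open>xs\<close> forces u = v, so the given edge at
        \<open>v\<close> is available at \<open>u\<close>.\<close>
      then obtain ws where "set (walk_edges u ws) \<subseteq> E" "last (u # ws) = u" "length ws = 2 * m"
        using pad_path[of u "[]" E y m] nb(1,2) by auto
      then show ?thesis using True m \<open>u = v\<close> by (intro exI[of _ ws]) auto
    next
      case False
      then obtain ws where "set (walk_edges u ws) \<subseteq> set (walk_edges u xs)"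
        "last (u # ws) = last (u # xs)" "length ws = length xs + 2 * m"
        using pad_walk[OF False, of u m] by blast
      then show ?thesis using xs(1) m by (intro exI[of _ ws]) (auto simp: proper_walk_def)
    qed
    then obtain ws where ws: "set (walk_edges u ws) \<subseteq> E" "last (u # ws) = v" "length ws = length ys"
      by blast
    have "proper_walk (\<lambda>e. c' (snd ` e)) (product_edges E F) (u, h) (zip ws ys) (v, h')"
      using walk_edges_zip_subset[of ws ys u E h F] last_zip_walk[of ws ys u h]
        map_snd_walk_edges_zip[of ws ys c' u h] ys(1) ws
      by (simp add: proper_walk_def)
    then have "proper_walk (product_coloring c c' k) (product_edges E F) (u, h) (zip ws ys) (v, h')"
      by (rule proper_walk_recolor) (simp add: product_coloring_eq_iff k')
    moreover have "distinct (zip (u # ws) (h # ys))" using ys(2) by (rule distinct_zipI2)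
    ultimately show ?thesis by auto
  qed
qed

subsection \<open>Arc walks and vertex walks\<close>

abbreviation edges_of :: "('a, 'b) pre_digraph \<Rightarrow> 'a set set" where
  "edges_of G \<equiv> edge_of G ` arcs G"

lemma (in sym_digraph) doubleton_in_edges_of_iff: "{a, b} \<in> edges_of G \<longleftrightarrow> a \<rightarrow> b"
  using sym_arcs unfolding symmetric_conv
  by (auto simp: edge_of_def doubleton_eq_iff arcs_ends_conv image_iff)

lemma (in wf_digraph) awalk_imp_walk_edges:
  assumes "awalk u p v"
  shows "\<exists>xs. awalk_verts u p = u # xs \<and> walk_edges u xs = map (edge_of G) p \<and> last (u # xs) = v"
  using assms
proof (induction p arbitrary: u)
  case (Cons e es)
  then obtain xs where "awalk_verts (head G e) es = head G e # xs"
    "walk_edges (head G e) xs = map (edge_of G) es" "last (head G e # xs) = v"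
    by (auto simp: awalk_Cons_iff)
  then show ?case using Cons.prems by (auto simp: awalk_Cons_iff edge_of_def)
qed (auto simp: awalk_Nil_iff)

lemma (in sym_digraph) walk_edges_imp_awalk:
  assumes "u \<in> verts G" "set (walk_edges u xs) \<subseteq> edges_of G"
  shows "\<exists>p. awalk u p (last (u # xs)) \<and> awalk_verts u p = u # xs \<and>
    map (edge_of G) p = walk_edges u xs"
  using assms
proof (induction xs arbitrary: u)
  case Nil
  then show ?case by (intro exI[of _ "[]"]) (auto simp: awalk_Nil_iff)
next
  case (Cons x xs)
  then have "u \<rightarrow> x" using doubleton_in_edges_of_iff by simp
  then obtain e where e: "e \<in> arcs G" "tail G e = u" "head G e = x" by blast
  then obtain p where p: "awalk x p (last (x # xs))" "awalk_verts x p = x # xs"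
    "map (edge_of G) p = walk_edges x xs"
    using Cons.IH[of x] Cons.prems(2) wellformed(2)[OF e(1)] by auto
  have "awalk u (e # p) (last (u # x # xs))" "awalk_verts u (e # p) = u # x # xs"
    "map (edge_of G) (e # p) = walk_edges u (x # xs)"
    using p e by (auto simp: awalk_Cons_iff edge_of_def)
  then show ?case by blast
qed

lemma (in wf_digraph) apath_imp_proper_walk:
  assumes "apath u p v" "properly_colored G c p"
  shows "\<exists>xs. proper_walk c (edges_of G) u xs v \<and> distinct (u # xs) \<and> length xs = length p"
proof -
  have "awalk u p v" using assms(1) by (simp add: apath_def)
  then obtain xs where xs: "awalk_verts u p = u # xs" "walk_edges u xs = map (edge_of G) p"
    "last (u # xs) = v"
    using awalk_imp_walk_edges by blast
  moreover have "set p \<subseteq> arcs G" using \<open>awalk u p v\<close> by auto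
  moreover have "length xs = length p" using xs(1) length_awalk_verts[of u p] by simp
  ultimately show ?thesis using assms
    by (intro exI[of _ xs]) (auto simp: proper_walk_def properly_colored_def apath_def comp_def)
qed

lemma (in sym_digraph) proper_walk_imp_apath:
  assumes "u \<in> verts G" "proper_walk c (edges_of G) u xs v" "distinct (u # xs)"
  shows "\<exists>p. apath u p v \<and> properly_colored G c p"
proof -
  obtain p where "awalk u p v" "awalk_verts u p = u # xs" "map (edge_of G) p = walk_edges u xs"
    using walk_edges_imp_awalk assms unfolding proper_walk_def by blast
  moreover from this have "map (\<lambda>e. c (edge_of G e)) p = map c (walk_edges u xs)"
    by (metis (no_types, lifting) comp_apply list.map_comp map_eq_conv)
  ultimately show ?thesis using assms by (auto simp: apath_def properly_colored_def proper_walk_def)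
qed

lemma (in wf_digraph) graph_cycle_imp_walk_edges:
  assumes "awalk u p u" "graph_cycle G p"
  shows "\<exists>xs. walk_edges u xs = map (edge_of G) p \<and> last (u # xs) = u \<and> distinct xs \<and>
    length xs = length p"
proof -
  obtain w where w: "distinct (tl (awalk_verts w p))" "p \<noteq> []"
    using assms(2) by (auto simp: graph_cycle_def cycle_def)
  obtain xs where xs: "awalk_verts u p = u # xs" "walk_edges u xs = map (edge_of G) p"
    "last (u # xs) = u"
    using awalk_imp_walk_edges[OF assms(1)] by blast
  \<comment> \<open>The witness \<open>w\<close> in \<open>cycle\<close> need not be
    \<open>u\<close> syntactically, but the vertex list of a nonempty arc list does not depend on
    the start argument.\<close>
  have "awalk_verts w p = u # xs" using xs(1) awalk_verts_ne_eq[OF w(2), of w u] by simp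
  then have "distinct xs" using w(1) by simp
  moreover have "length xs = length p" using xs(1) length_awalk_verts[of u p] by simp
  ultimately show ?thesis using xs by blast
qed

lemma (in sym_digraph) awalk_reverse:
  assumes "awalk u p v"
  shows "\<exists>q. awalk v q u \<and> awalk_verts v q = rev (awalk_verts u p) \<and>
    (\<forall>e\<in>set p. \<exists>e'\<in>set q. tail G e' = head G e \<and> head G e' = tail G e)"
  using assms
proof (induction p arbitrary: u)
  case Nil
  then show ?case by (intro exI[of _ "[]"]) (auto simp: awalk_Nil_iff)
next
  case (Cons e es)
  then have e: "e \<in> arcs G" "u = tail G e" "awalk (head G e) es v" by (auto simp: awalk_Cons_iff)
  obtain q where q: "awalk v q (head G e)" "awalk_verts v q = rev (awalk_verts (head G e) es)"
    "\<forall>e\<in>set es. \<exists>e'\<in>set q. tail G e' = head G e \<and> head G e' = tail G e"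
    using Cons.IH[OF e(3)] by blast
  obtain e' where e': "e' \<in> arcs G" "tail G e' = head G e" "head G e' = tail G e"
    using sym_arcs e(1) unfolding symmetric_conv by metis
  have e'w: "awalk (head G e) [e'] u" using e e' by (simp add: awalk_simps)
  then have w: "awalk v (q @ [e']) u" using q(1) awalk_appendI by blast
  moreover have "awalk_verts v (q @ [e']) = rev (awalk_verts u (e # es))"
    using awalk_verts_append[OF w] q(1,2) e e' by auto
  moreover have "\<forall>f\<in>set (e # es). \<exists>f'\<in>set (q @ [e']). tail G f' = head G f \<and> head G f' = tail G f"
    using q(3) e' by auto
  ultimately show ?case by blast
qed

section \<open>Odd and bipartite part as graphs\<close>

lemma odd_bip_part_simps [simp]:
  "verts (odd_part G) = verts G" "tail (odd_part G) = tail G" "head (odd_part G) = head G"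
  "verts (bip_part G) = verts G" "tail (bip_part G) = tail G" "head (bip_part G) = head G"
  "arcs (bip_part G) = arcs G - arcs (odd_part G)"
  by (auto simp: odd_part_def bip_part_def)

lemma arcs_odd_part_subset: "arcs (odd_part G) \<subseteq> arcs G"
  by (auto simp: odd_part_def)

text \<open>The odd part is defined through directed cycles. Reversing the cycle puts the opposite
  arc on an odd cycle as well, so the odd part and its complement are symmetric.\<close>

lemma (in graph) odd_part_reverse:
  assumes "e \<in> arcs (odd_part G)" "e' \<in> arcs G" "tail G e' = head G e" "head G e' = tail G e"
  shows "e' \<in> arcs (odd_part G)"
proof -
  obtain p where p: "graph_cycle G p" "odd (length p)" "e \<in> set p"
    using assms(1) by (auto simp: odd_part_def)
  then obtain u where u: "awalk u p u" "distinct (tl (awalk_verts u p))" "p \<noteq> []"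
    by (auto simp: graph_cycle_def cycle_def)
  obtain q where q: "awalk u q u" "awalk_verts u q = rev (awalk_verts u p)"
    "\<forall>e\<in>set p. \<exists>e'\<in>set q. tail G e' = head G e \<and> head G e' = tail G e"
    using awalk_reverse[OF u(1)] by blast
  have len: "length q = length p"
    using arg_cong[OF q(2), of length] by (simp add: length_awalk_verts)
  obtain f where f: "f \<in> set q" "tail G f = head G e" "head G f = tail G e" using q(3) p(3) by blast
  then have "f \<in> arcs G" using q(1) by auto
  then have "f = e'" using assms f no_multi_arcs by (simp add: arc_to_ends_def)
  have "distinct (tl (awalk_verts u q))"
  proof -
    obtain xs where xs: "awalk_verts u p = u # xs" "last (u # xs) = u"
      using awalk_imp_walk_edges[OF u(1)] by blast
    moreover have "xs \<noteq> []" using xs(1) length_awalk_verts[of u p] u(3) by auto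
    \<comment> \<open>The closed vertex list is \<open>u # ys @ [u]\<close>; its reversal has
      \<open>u\<close> at both ends again, so dropping the first entry leaves a distinct
      list.\<close>
    ultimately obtain ys where "xs = ys @ [u]" by (metis append_butlast_last_id last_ConsR)
    then show ?thesis using q(2) xs(1) u(2) by simp
  qed
  moreover have "q \<noteq> []" using f by auto
  ultimately have "graph_cycle G q"
    using q(1) p(1) len by (auto simp: graph_cycle_def cycle_def)
  then show ?thesis using p(2) len f(1) \<open>f = e'\<close> assms(2) by (auto simp: odd_part_def)
qed

text \<open>The arc cycle built from the vertex list uses one of the two arcs over the given edge;
  if it is not \<open>e\<close> itself, \<open>odd_part_reverse\<close> supplies
  \<open>e\<close>.\<close>

lemma (in graph) odd_cycle_in_odd_part:
  assumes "set (walk_edges w xs) \<subseteq> edges_of G" "last (w # xs) = w" "distinct xs"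
    "odd (length xs)" "3 \<le> length xs"
    and e: "e \<in> arcs G" "edge_of G e \<in> set (walk_edges w xs)"
  shows "e \<in> arcs (odd_part G)"
proof -
  have "w \<in> verts G"
  proof -
    obtain y ys where "xs = y # ys" using assms(5) by (cases xs) auto
    then have "w \<rightarrow> y" using assms(1) doubleton_in_edges_of_iff by simp
    then show ?thesis using adj_in_verts by blast
  qed
  then obtain p where p: "awalk w p w" "awalk_verts w p = w # xs"
    "map (edge_of G) p = walk_edges w xs"
    using walk_edges_imp_awalk assms(1,2) by metis
  have len: "length p = length xs" using p(2) length_awalk_verts[of w p] by simp
  then have "p \<noteq> []" using assms(5) by auto
  then have cyc: "graph_cycle G p"
    using p(1,2) assms(3,5) len by (auto simp: graph_cycle_def cycle_def)
  obtain f where f: "f \<in> set p" "edge_of G f = edge_of G e"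
    using e(2) p(3) by (metis (no_types, lifting) imageE list.set_map)
  have "f \<in> arcs G" using f p(1) by auto
  then have fo: "f \<in> arcs (odd_part G)"
    using cyc f assms(4) len by (auto simp: odd_part_def)
  from f(2) consider "tail G f = tail G e" "head G f = head G e"
    | "tail G e = head G f" "head G e = tail G f"
    by (auto simp: edge_of_def doubleton_eq_iff)
  then show ?thesis
  proof cases
    case 1
    then have "f = e" using \<open>f \<in> arcs G\<close> e(1) no_multi_arcs by (simp add: arc_to_ends_def)
    then show ?thesis using fo by simp
  next
    case 2
    then show ?thesis using odd_part_reverse[OF fo e(1)] by simp
  qed
qed

lemma (in graph) graph_odd_part: "graph (odd_part G)"
  and graph_bip_part: "graph (bip_part G)"
proof -
  have "subgraph (odd_part G) G" "subgraph (bip_part G) G"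
    using arcs_odd_part_subset[of G]
    by (auto intro!: subgraphI simp: compatible_def wf_digraph_def wf_digraph subset_iff)
  then have "digraph (odd_part G)" "digraph (bip_part G)" using digraph_subgraph by auto
  moreover have rev: "\<exists>e'\<in>arcs G. tail G e = head G e' \<and> head G e = tail G e'" if "e \<in> arcs G" for e
    using sym_arcs that unfolding symmetric_conv by blast
  have "symmetric (odd_part G)"
    unfolding symmetric_conv
  proof
    fix e assume e: "e \<in> arcs (odd_part G)"
    then have "e \<in> arcs G" using arcs_odd_part_subset by (rule rev_subsetD)
    then obtain e' where e': "e' \<in> arcs G" "tail G e = head G e'" "head G e = tail G e'"
      using rev by meson
    moreover have "e' \<in> arcs (odd_part G)" using odd_part_reverse[OF e] e' by simp
    ultimately show "\<exists>e'\<in>arcs (odd_part G). tail (odd_part G) e = head (odd_part G) e' \<and>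
        head (odd_part G) e = tail (odd_part G) e'" by auto
  qed
  moreover have "symmetric (bip_part G)"
    unfolding symmetric_conv
  proof
    fix e assume e: "e \<in> arcs (bip_part G)"
    then obtain e' where e': "e' \<in> arcs G" "tail G e = head G e'" "head G e = tail G e'"
      using rev by auto
    moreover have "e' \<notin> arcs (odd_part G)" using odd_part_reverse[of e' e] e e' by auto
    ultimately show "\<exists>e'\<in>arcs (bip_part G). tail (bip_part G) e = head (bip_part G) e' \<and>
        head (bip_part G) e = tail (bip_part G) e'" by auto
  qed
  ultimately show "graph (odd_part G)" "graph (bip_part G)"
    by (auto intro: digraph.graphI)
qed

section \<open>Maximal connected subgraphs as reachability classes\<close>

lemma (in graph) connected_subgraph_of_component:
  assumes sub: "subgraph C G" and con: "connected C" and u: "u \<in> verts C"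
  shows "subgraph C (G \<restriction> {v. u \<rightarrow>\<^sup>* v})"
proof (rule subgraphI)
  let ?D = "G \<restriction> {v. u \<rightarrow>\<^sup>* v}"
  interpret C: wf_digraph C using sub by (simp add: subgraph_def)
  have reach: "u \<rightarrow>\<^sup>* v" if "v \<in> verts C" for v
  proof -
    have "u \<rightarrow>\<^sup>*\<^bsub>mk_symmetric C\<^esub> v"
      using con u that by (auto simp: connected_def strongly_connected_def)
    then have "u \<rightarrow>\<^sup>*\<^bsub>mk_symmetric G\<^esub> v"
      by (rule pre_digraph.reachable_mono[OF _ subgraph_mk_symmetric[OF sub]])
    then show ?thesis using reachable_mk_symmetric_eq[OF sym_arcs] by simp
  qed
  show "verts C \<subseteq> verts ?D" using reach by auto
  show "arcs C \<subseteq> arcs ?D"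
  proof
    fix e assume e: "e \<in> arcs C"
    have "tail G e \<in> verts C" "head G e \<in> verts C" "e \<in> arcs G"
      using C.wellformed[OF e] sub e by (auto simp: subgraph_def compatible_def)
    then show "e \<in> arcs ?D" using reach by auto
  qed
  show "compatible ?D C" using sub by (auto simp: subgraph_def compatible_def)
qed (use sub wellformed_induce_subgraph in \<open>simp_all add: subgraph_def\<close>)

lemma (in graph) component_connected:
  assumes "u \<in> verts G"
  shows "subgraph (G \<restriction> {v. u \<rightarrow>\<^sup>* v}) G" "strongly_connected (G \<restriction> {v. u \<rightarrow>\<^sup>* v})"
    "connected (G \<restriction> {v. u \<rightarrow>\<^sup>* v})"
proof -
  let ?D = "G \<restriction> {v. u \<rightarrow>\<^sup>* v}"
  have D: "?D \<in> sccs" using induce_reachable_is_in_sccs assms by blast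
  show "subgraph ?D G" using D in_sccs_imp_induced induced_imp_subgraph by blast
  show sc: "strongly_connected ?D" using D by (simp add: sccs_def)
  have "wf_digraph ?D" by blast
  with sc show "connected ?D"
    unfolding connected_def strongly_connected_def
    by (metis pverts_mk_symmetric wf_digraph.reachable_mk_symmetricI with_proj_simps(1))
qed

text \<open>The class of \<open>u\<close> is connected and contains every connected subgraph through
  \<open>u\<close>, so maximality leaves no other choice.\<close>

lemma (in graph) component_eq:
  assumes "max_subgraph connected C" "u \<in> verts C"
  shows "C = G \<restriction> {v. u \<rightarrow>\<^sup>* v}"
proof -
  have "subgraph C G" "connected C" using assms(1) by (auto simp: max_subgraph_def)
  then have "subgraph C (G \<restriction> {v. u \<rightarrow>\<^sup>* v})"
    using connected_subgraph_of_component assms(2) by blast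
  moreover have "u \<in> verts G" using \<open>subgraph C G\<close> assms(2) by auto
  ultimately show ?thesis
    using assms(1) component_connected(1,3)[of u] unfolding max_subgraph_def by metis
qed

lemma (in graph) max_connected_component:
  assumes "u \<in> verts G"
  shows "max_subgraph connected (G \<restriction> {v. u \<rightarrow>\<^sup>* v})"
proof -
  let ?D = "G \<restriction> {v. u \<rightarrow>\<^sup>* v}"
  have "H = ?D" if H: "subgraph ?D H" "subgraph H G" "connected H" for H
  proof -
    have "u \<in> verts H" using H(1) reachable_refl[OF assms] by (auto simp: subgraph_def)
    then have "subgraph H ?D" using connected_subgraph_of_component H by blast
    then show "H = ?D" using H(1)
      by (intro pre_digraph.equality) (auto simp: subgraph_def compatible_def)
  qed
  then show ?thesis using component_connected[OF assms] unfolding max_subgraph_def by blast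
qed

subsection \<open>Components of the odd and bipartite parts\<close>

lemma (in wf_digraph) reachable_imp_walk:
  assumes "u \<rightarrow>\<^sup>* v"
  shows "\<exists>xs. set (walk_edges u xs) \<subseteq> edges_of G \<and> last (u # xs) = v \<and> distinct (u # xs)"
proof -
  obtain p where p: "apath u p v" using assms reachable_apath by blast
  then have w: "awalk u p v" by (simp add: apath_def)
  then obtain xs where "awalk_verts u p = u # xs" "walk_edges u xs = map (edge_of G) p"
    "last (u # xs) = v"
    using awalk_imp_walk_edges by blast
  moreover have "set p \<subseteq> arcs G" using w by (simp add: awalk_def)
  moreover have "distinct (awalk_verts u p)" using p by (simp add: apath_def)
  ultimately show ?thesis by (intro exI[of _ xs]) auto
qed

text \<open>For distinct ends the cycle alternative of \<open>path_or_cycle\<close> is void.\<close>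

lemma (in wf_digraph) odd_even_path:
  assumes "odd_even_proper_connected G c" "u \<in> verts G" "v \<in> verts G" "u \<noteq> v"
  shows "\<exists>xs. proper_walk c (edges_of G) u xs v \<and> distinct (u # xs) \<and> even (length xs) = b"
proof -
  obtain p where "path_or_cycle G u p v" "properly_colored G c p" "even (length p) = b"
    using assms(1-3) unfolding odd_even_proper_connected_def by (cases b) blast+
  then show ?thesis using apath_imp_proper_walk[of u p v c] assms(4)
    by (auto simp: path_or_cycle_def)
qed

text \<open>The only path from a vertex to itself is trivial and hence even, so an odd witness is a
  cycle.\<close>

lemma (in wf_digraph) odd_even_cycle:
  assumes "odd_even_proper_connected G c" "u \<in> verts G"
  shows "\<exists>xs. proper_walk c (edges_of G) u xs u \<and> distinct xs \<and> odd (length xs)"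
proof -
  obtain p where p: "path_or_cycle G u p u" "properly_colored G c p" "odd (length p)"
    using assms unfolding odd_even_proper_connected_def by blast
  have "p \<noteq> []" using p(3) by auto
  then have "\<not> apath u p u" using apath_nonempty_ends by blast
  then have w: "awalk u p u" "graph_cycle G p" using p(1) by (auto simp: path_or_cycle_def)
  then obtain xs where xs: "walk_edges u xs = map (edge_of G) p" "last (u # xs) = u" "distinct xs"
    "length xs = length p"
    using graph_cycle_imp_walk_edges by blast
  have "set p \<subseteq> arcs G" using w(1) by (simp add: awalk_def)
  then show ?thesis using xs p(2,3)
    by (intro exI[of _ xs]) (auto simp: proper_walk_def properly_colored_def comp_def)
qed

lemma (in wf_digraph) proper_connected_path:
  assumes "proper_connected G c" "u \<in> verts G" "v \<in> verts G" "u \<noteq> v"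
  shows "\<exists>xs. proper_walk c (edges_of G) u xs v \<and> distinct (u # xs)"
  using assms apath_imp_proper_walk unfolding proper_connected_def by blast

context graph
begin

lemma nontrivial_component_eq:
  assumes "C \<in> nontrivial_components G" "u \<in> verts C"
  shows "C = G \<restriction> {v. u \<rightarrow>\<^sup>* v}"
  using assms component_eq by (simp add: nontrivial_components_def)

lemma nontrivial_component_obtain:
  assumes "C \<in> nontrivial_components G"
  obtains u where "u \<in> verts G" "u \<in> verts C" "C = G \<restriction> {v. u \<rightarrow>\<^sup>* v}"
proof -
  have "verts C \<noteq> {}" "verts C \<subseteq> verts G"
    using assms by (auto simp: nontrivial_components_def max_subgraph_def subgraph_def)
  then show ?thesis using that nontrivial_component_eq[OF assms] by blast
qed

lemma nontrivial_component_simps: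
  assumes "C \<in> nontrivial_components G"
  shows "tail C = tail G" "head C = head G" "verts C \<subseteq> verts G" "arcs C \<subseteq> arcs G"
    "edge_of C = edge_of G" "strongly_connected C"
proof -
  from assms obtain u where u: "u \<in> verts G" "C = G \<restriction> {v. u \<rightarrow>\<^sup>* v}"
    by (rule nontrivial_component_obtain)
  note C = component_connected[OF u(1), folded u(2)]
  show t: "tail C = tail G" "head C = head G" and "verts C \<subseteq> verts G" "arcs C \<subseteq> arcs G"
    using C(1) by (auto simp: subgraph_def compatible_def)
  show "edge_of C = edge_of G" using t by (simp add: edge_of_def fun_eq_iff)
  show "strongly_connected C" by (rule C(2))
qed

lemma graph_nontrivial_component:
  assumes "C \<in> nontrivial_components G"
  shows "graph C"
proof -
  from assms obtain u where u: "u \<in> verts G" "C = G \<restriction> {v. u \<rightarrow>\<^sup>* v}"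
    by (rule nontrivial_component_obtain)
  note C = component_connected[OF u(1), folded u(2)]
  have "induced_subgraph C G"
    using C(1) unfolding u(2) by (intro induced_subgraphI) auto
  then have "symmetric C" using sym_arcs induced_graph_imp_symmetric by blast
  then show ?thesis using digraph_subgraph[OF C(1)] digraph.graphI by blast
qed

lemma nontrivial_component_closed:
  assumes "C \<in> nontrivial_components G" "e \<in> arcs G" "tail G e \<in> verts C"
  shows "e \<in> arcs C" "head G e \<in> verts C"
proof -
  let ?D = "G \<restriction> {v. tail G e \<rightarrow>\<^sup>* v}"
  have "tail G e \<rightarrow>\<^sup>* head G e" using assms(2) in_arcs_imp_in_arcs_ends by blast
  moreover have "tail G e \<rightarrow>\<^sup>* tail G e" using assms(2) by simp
  ultimately have "e \<in> arcs ?D" "head G e \<in> verts ?D" using assms(2) by auto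
  then show "e \<in> arcs C" "head G e \<in> verts C"
    using nontrivial_component_eq[OF assms(1,3)] by metis+
qed

lemma nontrivial_components_disjoint:
  assumes "C \<in> nontrivial_components G" "D \<in> nontrivial_components G" "x \<in> verts C" "x \<in> verts D"
  shows "C = D"
  using nontrivial_component_eq assms by metis

lemma arc_in_nontrivial_component:
  assumes "e \<in> arcs G"
  shows "\<exists>C\<in>nontrivial_components G. e \<in> arcs C \<and> tail G e \<in> verts C"
proof -
  let ?D = "G \<restriction> {v. tail G e \<rightarrow>\<^sup>* v}"
  have 1: "tail G e \<in> verts ?D" using assms by simp
  have 2: "head G e \<in> verts ?D" using assms in_arcs_imp_in_arcs_ends by auto
  have "verts ?D \<subseteq> verts G" by (auto simp: reachable_in_verts)
  then have "finite (verts ?D)" using finite_verts by (rule finite_subset)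
  then have "card {tail G e, head G e} \<le> card (verts ?D)" using 1 2 by (intro card_mono) auto
  then have "?D \<in> nontrivial_components G"
    using max_connected_component[of "tail G e"] assms no_loops[OF assms]
    by (simp add: nontrivial_components_def)
  moreover have "e \<in> arcs ?D" using assms 1 2 by simp
  ultimately show ?thesis using 1 by blast
qed

lemma finite_nontrivial_components: "finite (nontrivial_components G)"
proof -
  have "nontrivial_components G \<subseteq> (\<lambda>u. G \<restriction> {v. u \<rightarrow>\<^sup>* v}) ` verts G"
    using nontrivial_component_obtain by blast
  then show ?thesis using finite_verts by (meson finite_imageI finite_subset)
qed

lemma nontrivial_component_has_arc:
  assumes "C \<in> nontrivial_components G"
  shows "arcs C \<noteq> {}"
proof
  assume *: "arcs C = {}"
  from assms obtain u where u: "u \<in> verts C" by (rule nontrivial_component_obtain)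
  have "1 < card (verts C)" using assms by (simp add: nontrivial_components_def)
  then have "\<not> verts C \<subseteq> {u}" using card_mono[of "{u}" "verts C"] by auto
  then obtain v where v: "v \<in> verts C" "v \<noteq> u" by auto
  interpret C: graph C using graph_nontrivial_component[OF assms] .
  have "u \<rightarrow>\<^sup>*\<^bsub>C\<^esub> v" using nontrivial_component_simps(6)[OF assms] u v by blast
  then obtain xs where "set (walk_edges u xs) \<subseteq> edges_of C" "last (u # xs) = v"
    using C.reachable_imp_walk by blast
  then show False using * v by auto
qed

lemma singleton_notin_edges_of: "{v} \<notin> edges_of G"
proof
  assume "{v} \<in> edges_of G"
  then obtain e where "e \<in> arcs G" "{tail G e, head G e} = {v}" by (auto simp: edge_of_def)
  then show False using no_loops[of e] by (auto simp: doubleton_eq_iff)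
qed

lemma edges_of_bip_part_subset: "edges_of (bip_part G) \<subseteq> edges_of G"
  by (auto simp: edge_of_def)

text \<open>An odd closed walk would contain an odd cycle, whose edges belong to the odd part by
  definition.\<close>

lemma bip_part_closed_walk_even:
  assumes "set (walk_edges u xs) \<subseteq> edges_of (bip_part G)" "last (u # xs) = u"
  shows "even (length xs)"
proof (rule ccontr)
  assume odd: "odd (length xs)"
  have "{v} \<notin> edges_of (bip_part G)" for v using edges_of_bip_part_subset singleton_notin_edges_of by blast
  then obtain v ys where ys: "set (walk_edges v ys) \<subseteq> edges_of (bip_part G)" "last (v # ys) = v"
    "odd (length ys)" "distinct ys" "3 \<le> length ys"
    using odd_closed_walk_imp_odd_cycle[OF _ assms odd] by blast
  then obtain y zs where "ys = y # zs" by (cases ys) auto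
  then have hd: "{v, y} \<in> set (walk_edges v ys)" by simp
  then have "{v, y} \<in> edges_of (bip_part G)" using ys(1) by blast
  then obtain e where e: "e \<in> arcs G" "e \<notin> arcs (odd_part G)" "edge_of G e = {v, y}"
    by (auto simp: edge_of_def)
  have "set (walk_edges v ys) \<subseteq> edges_of G" using ys(1) edges_of_bip_part_subset by (rule subset_trans)
  then have "e \<in> arcs (odd_part G)"
    using odd_cycle_in_odd_part ys hd e by metis
  then show False using e by simp
qed

lemma connected_imp_reachable:
  assumes "connected G" "u \<in> verts G" "v \<in> verts G"
  shows "u \<rightarrow>\<^sup>* v"
  using symmetric_connected_imp_strongly_connected[OF sym_arcs assms(1)] assms(2,3) by blast

text \<open>Otherwise the bipartite part is all of the graph, every closed walk is even, and
  connectedness yields a bipartition.\<close>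

lemma odd_part_nonempty:
  assumes "connected G" "\<not> bipartite G"
  shows "arcs (odd_part G) \<noteq> {}"
proof
  assume "arcs (odd_part G) = {}"
  then have eq: "edges_of (bip_part G) = edges_of G" by (auto simp: edge_of_def)
  obtain r where r: "r \<in> verts G"
    using symmetric_connected_imp_strongly_connected[OF sym_arcs assms(1)]
    by (auto simp: strongly_connected_def)
  have "\<exists>s. bicolors s (edges_of G)"
  proof (rule bicolors_exists)
    show "even (length xs)" if "set (walk_edges u xs) \<subseteq> edges_of G" "last (u # xs) = u" for u xs
      using bip_part_closed_walk_even[unfolded eq, OF that] .
    show "\<exists>xs. set (walk_edges r xs) \<subseteq> edges_of G \<and> last (r # xs) = a" if "{a, b} \<in> edges_of G" for a b
    proof -
      have "a \<in> verts G" using that doubleton_in_edges_of_iff adj_in_verts by simp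
      then show ?thesis
        using reachable_imp_walk connected_imp_reachable[OF assms(1) r] by blast
    qed
  qed
  then obtain s where s: "bicolors s (edges_of G)" by blast
  have "s (tail G e) \<noteq> s (head G e)" if "e \<in> arcs G" for e
    using s that unfolding bicolors_def by (metis edge_of_def imageI)
  then have "bipartite G" unfolding bipartite_def
    by (intro exI[of _ "{v \<in> verts G. s v}"] exI[of _ "{v \<in> verts G. \<not> s v}"]) auto
  with assms(2) show False by simp
qed

text \<open>If no odd arc started in \<open>D\<close>, then \<open>D\<close> would be closed under
  all arcs and contain every vertex, in particular the tail of an arc of the nonempty odd
  part.\<close>

lemma bip_component_attached:
  assumes "connected G" "\<not> bipartite G" "D \<in> nontrivial_components (bip_part G)"
  shows "\<exists>x C. x \<in> verts D \<and> C \<in> nontrivial_components (odd_part G) \<and> x \<in> verts C"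
proof -
  interpret O: graph "odd_part G" by (rule graph_odd_part)
  interpret B: graph "bip_part G" by (rule graph_bip_part)
  have "\<exists>e\<in>arcs (odd_part G). tail G e \<in> verts D"
  proof (rule ccontr)
    assume none: "\<not> ?thesis"
    have closed: "head G e \<in> verts D" if "e \<in> arcs G" "tail G e \<in> verts D" for e
      using B.nontrivial_component_closed(2)[OF assms(3), of e] none that by auto
    obtain u where u: "u \<in> verts G" "u \<in> verts D"
      using B.nontrivial_component_obtain[OF assms(3)] unfolding odd_bip_part_simps by metis
    have "v \<in> verts D" if "u \<rightarrow>\<^sup>* v" for v
      using that
    proof (induction rule: reachable_induct)
      case (step x y)
      then show ?case using closed by blast
    qed (use u in simp)
    then have "v \<in> verts D" if "v \<in> verts G" for v
      using connected_imp_reachable[OF assms(1) u(1) that] by simp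
    moreover obtain e where e: "e \<in> arcs (odd_part G)" using odd_part_nonempty assms by blast
    ultimately show False using none O.tail_in_verts[OF e] e by (metis odd_bip_part_simps(1,2))
  qed
  then obtain e where e: "e \<in> arcs (odd_part G)" "tail G e \<in> verts D" by blast
  then show ?thesis using O.arc_in_nontrivial_component[OF e(1)] by auto
qed

text \<open>Otherwise an ear of the odd component inside the bipartite component would close up, with a
  path of suitable parity in the odd component, to an odd cycle.\<close>

lemma odd_bip_components_share:
  assumes C: "C \<in> nontrivial_components (odd_part G)" and D: "D \<in> nontrivial_components (bip_part G)"
    and c: "odd_even_proper_connected C c"
    and x: "x \<in> verts C" "x \<in> verts D" and y: "y \<in> verts C" "y \<in> verts D"
  shows "x = y"
proof (rule ccontr)
  assume "x \<noteq> y"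
  interpret O: graph "odd_part G" by (rule graph_odd_part)
  interpret B: graph "bip_part G" by (rule graph_bip_part)
  interpret C: graph C using O.graph_nontrivial_component[OF C] .
  interpret D: graph D using B.graph_nontrivial_component[OF D] .
  note Cs = O.nontrivial_component_simps[OF C] and Ds = B.nontrivial_component_simps[OF D]
  have eC: "edges_of C \<subseteq> edges_of G"
    using Cs arcs_odd_part_subset[of G] by (force simp: edge_of_def)
  have eD: "edges_of D \<subseteq> edges_of (bip_part G)" using Ds(4,5) by auto
  have "x \<rightarrow>\<^sup>*\<^bsub>D\<^esub> y" using Ds(6) x y by blast
  then obtain ps where ps: "set (walk_edges x ps) \<subseteq> edges_of D" "last (x # ps) = y" "distinct (x # ps)"
    using D.reachable_imp_walk by blast
  have "y \<in> set ps" using ps(2) \<open>x \<noteq> y\<close> by (auto split: if_splits)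
  \<comment> \<open>\<open>z\<close> is the first return of the path in \<open>D\<close> to
    \<open>C\<close>, so the ear from \<open>x\<close> to \<open>z\<close> has its interior outside
    \<open>C\<close>.\<close>
  then obtain qs z rs where q: "ps = qs @ z # rs" "z \<in> verts C" "\<forall>v\<in>set qs. v \<notin> verts C"
    using y(1) split_list_first_prop[of ps "\<lambda>v. v \<in> verts C"] by blast
  have qD: "set (walk_edges x (qs @ [z])) \<subseteq> edges_of D"
    using ps(1) q(1) by (auto simp: walk_edges_append)
  have "z \<noteq> x" using ps(3) q(1) by auto
  \<comment> \<open>The way back inside \<open>C\<close> is chosen with the parity opposite to that
    of the ear.\<close>
  then obtain ws where ws: "proper_walk c (edges_of C) z ws x" "distinct (z # ws)"
    "even (length ws) = odd (length (qs @ [z]))"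
    using C.odd_even_path[OF c q(2) x(1)] by blast
  have wsC: "set (z # ws) \<subseteq> verts C"
  proof (rule walk_vertices_subset)
    show "set (walk_edges z ws) \<subseteq> edges_of C" using ws(1) by (simp add: proper_walk_def)
    show "e \<subseteq> verts C" if "e \<in> edges_of C" for e using that by (auto simp: edge_of_def)
  qed (rule q(2))
  let ?xs = "(qs @ [z]) @ ws"
  have "ws \<noteq> []" using ws(1) \<open>z \<noteq> x\<close> by auto
  have odd: "odd (length ?xs)" using ws(3) by auto
  moreover have "2 \<le> length ?xs" using \<open>ws \<noteq> []\<close> by (cases ws) auto
  ultimately have len: "3 \<le> length ?xs" by presburger
  have edges: "walk_edges x ?xs = walk_edges x (qs @ [z]) @ walk_edges z ws"
    by (simp add: walk_edges_append)
  have sub: "set (walk_edges x ?xs) \<subseteq> edges_of G"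
  proof -
    have "set (walk_edges x (qs @ [z])) \<subseteq> edges_of G"
      using subset_trans[OF qD subset_trans[OF eD edges_of_bip_part_subset]] .
    moreover have "set (walk_edges z ws) \<subseteq> edges_of G" using ws(1) eC by (auto simp: proper_walk_def)
    ultimately show ?thesis unfolding edges by simp
  qed
  have last: "last (x # ?xs) = x" using ws(1) \<open>ws \<noteq> []\<close> by (simp add: proper_walk_def)
  have "distinct ?xs" using ps(3) q ws(2) wsC by auto
  note odd_in = odd_cycle_in_odd_part[OF sub last this odd len]
  \<comment> \<open>Any ear edge gives the contradiction: it lies in the bipartite part and on an
    odd cycle.\<close>
  obtain e where e: "e \<in> arcs D" "edge_of D e \<in> set (walk_edges x (qs @ [z]))"
  proof -
    have "hd (walk_edges x (qs @ [z])) \<in> set (walk_edges x (qs @ [z]))" by (simp del: append_is_Nil_conv)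
    then show ?thesis using qD that by (metis imageE subsetD)
  qed
  have "edge_of D e = edge_of G e" using Ds by (simp add: edge_of_def)
  then have "e \<in> arcs (odd_part G)" using odd_in[of e] e Ds(4) edges by auto
  then show False using e(1) Ds(4) by auto
qed

end

subsection \<open>Parity-controlled colorings and the bound\<close>

lemma sum_eq_enatE:
  fixes f :: "'a \<Rightarrow> enat"
  assumes "finite A" "sum f A = enat n"
  obtains k where "\<And>x. x \<in> A \<Longrightarrow> f x = enat (k x)" "sum k A = n"
proof
  show f: "f x = enat (the_enat (f x))" if "x \<in> A" for x
  proof -
    have "f x \<le> sum f A" using assms(1) that by (intro member_le_sum) auto
    then show ?thesis using assms(2) by (cases "f x") auto
  qed
  have "sum f A = (\<Sum>x\<in>A. enat (the_enat (f x)))" using f by (intro sum.cong) auto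
  also have "\<dots> = enat (\<Sum>x\<in>A. the_enat (f x))"
    using assms(1) by (induction rule: finite_induct) (auto simp: zero_enat_def)
  finally show "(\<Sum>x\<in>A. the_enat (f x)) = n" using assms(2) by simp
qed

text \<open>A finite infimum excludes the empty set, and on a nonempty set it is a least
  element.\<close>

lemma Inf_enat_attained:
  assumes "Inf {enat k |k. P k} = enat n"
  shows "P n"
proof -
  have "{enat k |k. P k} \<noteq> {}" using assms by (metis Inf_enat_def enat.distinct(1))
  then have "Inf {enat k |k. P k} \<in> {enat k |k. P k}"
    unfolding Inf_enat_def by (auto intro: LeastI)
  then show ?thesis using assms by auto
qed

lemma pc_attained: "pc G = enat k \<Longrightarrow> \<exists>c. k_edge_coloring G k c \<and> proper_connected G c"
  unfolding pc_def by (rule Inf_enat_attained)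

lemma oepc_attained: "oepc G = enat k \<Longrightarrow> \<exists>c. k_edge_coloring G k c \<and> odd_even_proper_connected G c"
  unfolding oepc_def by (rule Inf_enat_attained)

lemma (in graph) incident_arc:
  assumes "connected G" "arcs G \<noteq> {}" "u \<in> verts G"
  shows "\<exists>e\<in>arcs G. tail G e = u"
proof -
  obtain e where e: "e \<in> arcs G" using assms(2) by blast
  show ?thesis
  proof (cases "tail G e = u")
    case False
    have "u \<rightarrow>\<^sup>* tail G e" using connected_imp_reachable assms e by simp
    then show ?thesis
      by (cases rule: converse_reachable_cases) (use False in \<open>auto simp: arcs_ends_conv\<close>)
  qed (use e in blast)
qed

text \<open>The nontrivial components of both parts form a \<open>piece_decomposition\<close>.
  Components of the same part are disjoint; an odd and a bipartite one meet in at most one vertex by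
  \<open>odd_bip_components_share\<close>.\<close>

lemma (in graph) proper_parity_coloring:
  assumes con: "connected G" and nonbip: "\<not> bipartite G" and K: "b_sum G + o_sum G = enat K"
  shows "\<exists>c. (\<forall>e\<in>edges_of G. c e < K) \<and>
    (\<forall>u\<in>verts G. \<forall>v\<in>verts G. \<forall>b. \<exists>xs. proper_walk c (edges_of G) u xs v \<and>
       distinct (with_parity True (u # xs)) \<and> even (length xs) = b)"
proof -
  interpret O: graph "odd_part G" by (rule graph_odd_part)
  interpret B: graph "bip_part G" by (rule graph_bip_part)
  define IO where "IO = nontrivial_components (odd_part G)"
  define IB where "IB = nontrivial_components (bip_part G)"
  have fin: "finite IO" "finite IB"
    unfolding IO_def IB_def
    using O.finite_nontrivial_components B.finite_nontrivial_components by auto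
  have IOs: "tail C = tail G" "head C = head G" "verts C \<subseteq> verts G" "arcs C \<subseteq> arcs (odd_part G)"
    "graph C" "strongly_connected C" "arcs C \<noteq> {}" if "C \<in> IO" for C
    using O.nontrivial_component_simps[of C] O.graph_nontrivial_component[of C]
      O.nontrivial_component_has_arc[of C] that by (auto simp: IO_def)
  have IBs: "tail C = tail G" "head C = head G" "verts C \<subseteq> verts G"
    "arcs C \<subseteq> arcs G - arcs (odd_part G)"
    "graph C" "strongly_connected C" "arcs C \<noteq> {}" if "C \<in> IB" for C
    using B.nontrivial_component_simps[of C] B.graph_nontrivial_component[of C]
      B.nontrivial_component_has_arc[of C] that by (auto simp: IB_def)
  have disj: "IB \<inter> IO = {}"
  proof (rule ccontr)
    assume "IB \<inter> IO \<noteq> {}"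
    then obtain C where "C \<in> IB" "C \<in> IO" by blast
    then show False using IOs(4,7)[of C] IBs(4)[of C] by blast
  qed
  define I where "I = IB \<union> IO"
  have Is: "tail C = tail G" "head C = head G" "verts C \<subseteq> verts G" "arcs C \<subseteq> arcs G" "graph C"
    if "C \<in> I" for C
    using that IOs[of C] IBs[of C] arcs_odd_part_subset[of G] unfolding I_def by auto
  have edge: "edge_of C = edge_of G" if "C \<in> I" for C
    using Is(1,2)[OF that] by (simp add: edge_of_def fun_eq_iff)
  \<comment> \<open>Both sums become one over all pieces, with membership in \<open>IO\<close>
    deciding which connection number is charged; this relies on the families being disjoint.\<close>
  have "(\<Sum>C\<in>I. if C \<in> IO then oepc C else pc C) = enat K"
  proof -
    have "(\<Sum>C\<in>IB. if C \<in> IO then oepc C else pc C) = (\<Sum>C\<in>IB. pc C)"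
      "(\<Sum>C\<in>IO. if C \<in> IO then oepc C else pc C) = (\<Sum>C\<in>IO. oepc C)"
      using disj by (auto intro!: sum.cong)
    then show ?thesis using K fin disj
      by (simp add: I_def b_sum_def o_sum_def IO_def[symmetric] IB_def[symmetric] sum.union_disjoint)
  qed
  then obtain k where k: "\<And>C. C \<in> I \<Longrightarrow> (if C \<in> IO then oepc C else pc C) = enat (k C)" "sum k I = K"
    using sum_eq_enatE[of I] fin by (auto simp: I_def)
  have "\<exists>c. k_edge_coloring C (k C) c \<and> (C \<in> IO \<longrightarrow> odd_even_proper_connected C c) \<and>
      (C \<notin> IO \<longrightarrow> proper_connected C c)" if "C \<in> I" for C
    using k(1)[OF that] pc_attained[of C "k C"] oepc_attained[of C "k C"] by (cases "C \<in> IO") auto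
  then obtain col where col: "\<And>C. C \<in> I \<Longrightarrow> k_edge_coloring C (k C) (col C)"
    "\<And>C. C \<in> IO \<Longrightarrow> odd_even_proper_connected C (col C)"
    "\<And>C. C \<in> IB \<Longrightarrow> proper_connected C (col C)"
    using disj unfolding I_def by (metis UnCI disjoint_iff)
  have cover: "(\<Union>C\<in>I. edges_of C) = edges_of G"
  proof
    show "(\<Union>C\<in>I. edges_of C) \<subseteq> edges_of G" using edge Is(4) by fastforce
    show "edges_of G \<subseteq> (\<Union>C\<in>I. edges_of C)"
    proof
      fix s assume "s \<in> edges_of G"
      then obtain e where e: "e \<in> arcs G" "s = edge_of G e" by blast
      then consider "e \<in> arcs (odd_part G)" | "e \<in> arcs (bip_part G)" by auto
      then obtain C where C: "C \<in> I" "e \<in> arcs C"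
        using O.arc_in_nontrivial_component B.arc_in_nontrivial_component
        unfolding I_def IO_def IB_def by cases blast+
      then have "s \<in> edges_of C" using e edge[OF C(1)] by auto
      then show "s \<in> (\<Union>C\<in>I. edges_of C)" using C(1) by blast
    qed
  qed
  have arcs: "arcs G \<noteq> {}"
    using odd_part_nonempty[OF con nonbip] arcs_odd_part_subset[of G] by blast
  have vcover: "verts G \<subseteq> (\<Union>C\<in>I. verts C)"
  proof
    fix u assume u: "u \<in> verts G"
    then obtain e where e: "e \<in> arcs G" "tail G e = u" using incident_arc con arcs by blast
    then have "edge_of G e \<in> (\<Union>C\<in>I. edges_of C)" unfolding cover by blast
    then obtain C f where C: "C \<in> I" "f \<in> arcs C" "edge_of G e = edge_of C f" by blast
    interpret C: graph C using Is(5)[OF C(1)] .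
    have "u \<in> {tail C f, head C f}" using C(3) e unfolding edge_of_def by blast
    then have "u \<in> verts C" using C.wellformed[OF C(2)] by auto
    then show "u \<in> (\<Union>C\<in>I. verts C)" using C(1) by blast
  qed
  have share_mixed: "x = y" if "C \<in> IO" "D \<in> IB" "x \<in> verts C \<inter> verts D" "y \<in> verts C \<inter> verts D"
    for C D x y
    using odd_bip_components_share[of C D "col C" x y] that col(2) by (auto simp: IO_def IB_def)
  interpret piece_decomposition I verts edges_of "\<lambda>C. C \<in> IO" k col
  proof
    show "finite I" using fin by (simp add: I_def)
  next
    fix C e assume C: "C \<in> I" "e \<in> edges_of C"
    then obtain f where f: "f \<in> arcs C" "e = {tail C f, head C f}" by (auto simp: edge_of_def)
    interpret C: graph C using Is(5)[OF C(1)] .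
    show "e \<subseteq> verts C" using f by auto
    show "\<exists>a b. a \<noteq> b \<and> e = {a, b}" using f C.no_loops by blast
    show "col C e < k C" using col(1)[OF C(1)] C(2) by (auto simp: k_edge_coloring_def)
  next
    fix C D x y
    assume "C \<in> I" "D \<in> I" "x \<in> verts C \<inter> verts D" "y \<in> verts C \<inter> verts D" "x \<noteq> y"
    then show "C = D"
      using share_mixed[of C D x y] share_mixed[of D C x y]
        O.nontrivial_components_disjoint[of C D x] B.nontrivial_components_disjoint[of C D x]
      unfolding I_def IO_def IB_def by blast
  next
    fix C D x
    assume "C \<in> I" "D \<in> I" "C \<notin> IO" "D \<notin> IO" "x \<in> verts C \<inter> verts D"
    then show "C = D"
      using B.nontrivial_components_disjoint[of C D x] unfolding I_def IO_def IB_def by blast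
  next
    fix C u v b assume C: "C \<in> I" "u \<in> verts C" "v \<in> verts C" "u \<noteq> v"
    interpret C: graph C using Is(5)[OF C(1)] .
    show "\<exists>xs. proper_walk (col C) (edges_of C) u xs v \<and> distinct (u # xs) \<and>
        (C \<in> IO \<longrightarrow> even (length xs) = b)"
    proof (cases "C \<in> IO")
      case True
      then show ?thesis using C.odd_even_path[OF col(2) C(2-4)] by blast
    next
      case False
      then have "C \<in> IB" using C(1) by (simp add: I_def)
      then show ?thesis using C.proper_connected_path[OF col(3) C(2-4)] False by blast
    qed
  next
    fix C u assume C: "C \<in> I" "C \<in> IO" "u \<in> verts C"
    interpret C: graph C using Is(5)[OF C(1)] .
    show "\<exists>xs. proper_walk (col C) (edges_of C) u xs u \<and> distinct xs \<and> odd (length xs)"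
      using C.odd_even_cycle[OF col(2) C(3)] C(2) by blast
  next
    fix C assume C: "C \<in> I" "C \<notin> IO"
    then have CB: "C \<in> IB" by (simp add: I_def)
    interpret C: graph C using Is(5)[OF C(1)] .
    from CB obtain r where r: "r \<in> verts C"
      unfolding IB_def by (rule B.nontrivial_component_obtain)
    have sub: "edges_of C \<subseteq> edges_of (bip_part G)"
      using IBs(1,2,4)[OF CB] by (auto simp: edge_of_def)
    show "\<exists>s. bicolors s (edges_of C)"
    proof (rule bicolors_exists)
      show "even (length xs)" if "set (walk_edges u xs) \<subseteq> edges_of C" "last (u # xs) = u" for u xs
        using bip_part_closed_walk_even[OF subset_trans[OF that(1) sub] that(2)] .
      show "\<exists>xs. set (walk_edges r xs) \<subseteq> edges_of C \<and> last (r # xs) = a"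
        if "{a, b} \<in> edges_of C" for a b
      proof -
        have "a \<in> verts C" using that C.doubleton_in_edges_of_iff C.adj_in_verts by simp
        then have "r \<rightarrow>\<^sup>*\<^bsub>C\<^esub> a" using IBs(6)[OF CB] r by blast
        then show ?thesis using C.reachable_imp_walk by blast
      qed
    qed
    obtain x D where "x \<in> verts C" "D \<in> IO" "x \<in> verts D"
      using bip_component_attached[OF con nonbip] CB unfolding IB_def IO_def by blast
    then show "\<exists>x D. x \<in> verts C \<and> D \<in> I \<and> D \<in> IO \<and> x \<in> verts D" unfolding I_def by blast
  next
    fix u v assume "u \<in> (\<Union>C\<in>I. verts C)" "v \<in> (\<Union>C\<in>I. verts C)"
    then have "u \<in> verts G" "v \<in> verts G" using Is(3) by blast+
    then show "\<exists>xs. set (walk_edges u xs) \<subseteq> (\<Union>C\<in>I. edges_of C) \<and> last (u # xs) = v"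
      unfolding cover using reachable_imp_walk connected_imp_reachable[OF con] by blast
  qed
  obtain c where c: "combines c" "\<forall>C\<in>I. \<forall>e\<in>edges_of C. c e < sum k I"
    using combines_exists by blast
  show ?thesis
  proof (intro exI[of _ c] conjI ballI allI)
    show "c e < K" if "e \<in> edges_of G" for e
      using that c(2) k(2) unfolding cover[symmetric] by blast
    show "\<exists>xs. proper_walk c (edges_of G) u xs v \<and> distinct (with_parity True (u # xs)) \<and>
        even (length xs) = b" if "u \<in> verts G" "v \<in> verts G" for u v b
      using proper_walk_of_parity[OF c(1) subsetD[OF vcover that(1)] subsetD[OF vcover that(2)]]
      unfolding cover .
  qed
qed

text \<open>Speaking of vertex and edge sets instead of arcs allows the two factors to be exchanged
  without transporting arc types.\<close>

definition proper_connected_edges :: "'a set \<Rightarrow> 'a set set \<Rightarrow> ('a set \<Rightarrow> nat) \<Rightarrow> bool" where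
  "proper_connected_edges V E c \<longleftrightarrow>
     (\<forall>u\<in>V. \<forall>v\<in>V. u \<noteq> v \<longrightarrow> (\<exists>xs. proper_walk c E u xs v \<and> distinct (u # xs)))"

lemma (in graph) proper_connected_iff:
  "proper_connected G c \<longleftrightarrow> proper_connected_edges (verts G) (edges_of G) c"
  unfolding proper_connected_def proper_connected_edges_def
  using apath_imp_proper_walk proper_walk_imp_apath by blast

text \<open>Two edges span both diagonals in \<open>product_edges\<close>; both occur as arcs
  because every edge of a factor is present in both directions.\<close>

lemma edges_of_direct_product:
  assumes "graph G" "graph H"
  shows "edges_of (direct_product G H) = product_edges (edges_of G) (edges_of H)"
proof -
  interpret G: graph G by fact
  interpret H: graph H by fact
  interpret P: graph "direct_product G H" using graph_direct_product assms by blast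
  show ?thesis
  proof (intro set_eqI iffI)
    fix s assume "s \<in> edges_of (direct_product G H)"
    then obtain e f where "e \<in> arcs G" "f \<in> arcs H"
      "s = {(tail G e, tail H f), (head G e, head H f)}"
      by (auto simp: edge_of_def direct_product_def)
    then show "s \<in> product_edges (edges_of G) (edges_of H)"
      by (auto simp: edge_of_def intro!: product_edgesI)
  next
    fix s assume "s \<in> product_edges (edges_of G) (edges_of H)"
    then obtain a b x y where "s = {(a, x), (b, y)}" "{a, b} \<in> edges_of G" "{x, y} \<in> edges_of H"
      by (auto simp: product_edges_def)
    then show "s \<in> edges_of (direct_product G H)"
      by (simp add: G.doubleton_in_edges_of_iff H.doubleton_in_edges_of_iff
          P.doubleton_in_edges_of_iff direct_product_adjacent)
  qed
qed

text \<open>The parity freedom is needed in \<open>G\<close> only: the proper path in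
  \<open>H\<close> comes first, with whatever parity it has, and the walk in \<open>G\<close>
  follows it.\<close>

lemma product_edges_coloring:
  assumes "graph G" "connected G" "\<not> bipartite G" "graph H" "connected H" "\<not> bipartite H"
    and K: "b_sum G + o_sum G = enat K" and k: "pc H = enat k"
  shows "\<exists>c. (\<forall>e\<in>product_edges (edges_of G) (edges_of H). c e < k * K) \<and>
    proper_connected_edges (verts G \<times> verts H) (product_edges (edges_of G) (edges_of H)) c"
proof -
  interpret G: graph G by fact
  interpret H: graph H by fact
  obtain c where c: "\<forall>e\<in>edges_of G. c e < K"
    "\<forall>u\<in>verts G. \<forall>v\<in>verts G. \<forall>b. \<exists>xs. proper_walk c (edges_of G) u xs v \<and>
       distinct (with_parity True (u # xs)) \<and> even (length xs) = b"
    using G.proper_parity_coloring assms by blast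
  obtain c' where c': "k_edge_coloring H k c'" "proper_connected H c'" using pc_attained[OF k] by blast
  then have k': "c' e < k" if "e \<in> edges_of H" for e
    using that by (auto simp: k_edge_coloring_def)
  have arcs: "arcs G \<noteq> {}" "arcs H \<noteq> {}"
    using G.odd_part_nonempty[OF assms(2,3)] H.odd_part_nonempty[OF assms(5,6)]
      arcs_odd_part_subset[of G] arcs_odd_part_subset[of H] by auto
  have Gn: "\<exists>y. {v, y} \<in> edges_of G \<and> v \<noteq> y" if v: "v \<in> verts G" for v
  proof -
    obtain e where "e \<in> arcs G" "tail G e = v" using G.incident_arc assms(2) arcs(1) v by blast
    then show ?thesis using G.no_loops by (auto simp: edge_of_def)
  qed
  have Hn: "\<exists>y. {v, y} \<in> edges_of H \<and> v \<noteq> y" if v: "v \<in> verts H" for v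
  proof -
    obtain e where "e \<in> arcs H" "tail H e = v" using H.incident_arc assms(5) arcs(2) v by blast
    then show ?thesis using H.no_loops by (auto simp: edge_of_def)
  qed
  have "product_coloring c c' k e < k * K" if e: "e \<in> product_edges (edges_of G) (edges_of H)" for e
  proof -
    have "c (fst ` e) < K" "c' (snd ` e) < k" using e c(1) k' by (auto simp: product_edges_def)
    then have "product_coloring c c' k e < (c (fst ` e) + 1) * k" by (simp add: product_coloring_def)
    also have "\<dots> \<le> K * k" using \<open>c (fst ` e) < K\<close> by (intro mult_right_mono) auto
    finally show ?thesis by (simp add: mult.commute)
  qed
  moreover have "proper_connected_edges (verts G \<times> verts H)
      (product_edges (edges_of G) (edges_of H)) (product_coloring c c' k)"
    unfolding proper_connected_edges_def
  proof (intro ballI impI)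
    fix p q assume pq: "p \<in> verts G \<times> verts H" "q \<in> verts G \<times> verts H" "p \<noteq> q"
    obtain u h where p: "p = (u, h)" "u \<in> verts G" "h \<in> verts H" using pq by auto
    obtain v h' where q: "q = (v, h')" "v \<in> verts G" "h' \<in> verts H" using pq by auto
    have "\<exists>ys. proper_walk c' (edges_of H) h ys h' \<and> distinct (h # ys)"
    proof (cases "h = h'")
      case True
      then show ?thesis by (intro exI[of _ "[]"]) simp
    next
      case False
      then show ?thesis using H.proper_connected_path[OF c'(2) p(3) q(3)] by blast
    qed
    then obtain ys where ys: "proper_walk c' (edges_of H) h ys h'" "distinct (h # ys)" by blast
    obtain xs where xs: "proper_walk c (edges_of G) u xs v" "distinct (with_parity True (u # xs))"
      "even (length xs) = even (length ys)"
      using c(2) p(2) q(2) by blast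
    obtain y z where "{v, y} \<in> edges_of G" "v \<noteq> y" "{h, z} \<in> edges_of H" "h \<noteq> z"
      using Gn Hn q(2) p(3) by blast
    from product_path[OF this xs(1,2) ys xs(3) k']
    show "\<exists>xs. proper_walk (product_coloring c c' k) (product_edges (edges_of G) (edges_of H)) p xs q \<and>
        distinct (p # xs)" unfolding p q by blast
  qed
  ultimately show ?thesis by blast
qed

lemma pc_le:
  assumes "graph G" "\<forall>e\<in>edges_of G. c e < k" "proper_connected_edges (verts G) (edges_of G) c"
  shows "pc G \<le> enat k"
proof -
  interpret graph G by fact
  have "k_edge_coloring G k c" "proper_connected G c"
    using assms(2,3) by (auto simp: k_edge_coloring_def proper_connected_iff)
  then show ?thesis unfolding pc_def by (intro Inf_lower) blast
qed

section \<open>Exchanging the two factors\<close>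

lemma walk_edges_map: "walk_edges (f u) (map f xs) = map (image f) (walk_edges u xs)"
  by (induction xs arbitrary: u) auto

lemma product_edges_swap: "(image prod.swap) ` product_edges E F = product_edges F E"
proof -
  \<comment> \<open>This inclusion is stated for arbitrary factor types because it is applied in
    both directions; since swapping is an involution, the converse inclusion follows.\<close>
  have sub: "image prod.swap ` product_edges E F \<subseteq> product_edges F E"
    for E :: "'x set set" and F :: "'y set set"
  proof
    fix e assume "e \<in> image prod.swap ` product_edges E F"
    then obtain a b x y where "e = prod.swap ` {(a, x), (b, y)}" "{a, b} \<in> E" "{x, y} \<in> F"
      by (auto simp: product_edges_def)
    then show "e \<in> product_edges F E" by (simp add: product_edgesI)
  qed
  have "e \<in> image prod.swap ` product_edges E F" if "e \<in> product_edges F E" for e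
  proof -
    have "e = prod.swap ` (prod.swap ` e)" by (simp add: image_image)
    moreover have "prod.swap ` e \<in> product_edges E F" using sub that by blast
    ultimately show ?thesis by (rule image_eqI)
  qed
  then show ?thesis using sub[of E F] by blast
qed

lemma proper_connected_edges_swap:
  assumes "proper_connected_edges (A \<times> B) (product_edges E F) c"
  shows "proper_connected_edges (B \<times> A) (product_edges F E) (\<lambda>e. c (prod.swap ` e))"
  unfolding proper_connected_edges_def
proof (intro ballI impI)
  fix u v :: "'b \<times> 'a"
  assume "u \<in> B \<times> A" "v \<in> B \<times> A" "u \<noteq> v"
  then have "prod.swap u \<in> A \<times> B" "prod.swap v \<in> A \<times> B" "prod.swap u \<noteq> prod.swap v"
    by (auto simp: prod.swap_def)
  then obtain xs where xs: "proper_walk c (product_edges E F) (prod.swap u) xs (prod.swap v)"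
    "distinct (prod.swap u # xs)"
    using assms unfolding proper_connected_edges_def by meson
  let ?ys = "map prod.swap xs"
  have e: "walk_edges u ?ys = map (image prod.swap) (walk_edges (prod.swap u) xs)"
    using walk_edges_map[of prod.swap "prod.swap u" xs] by simp
  have "set (walk_edges u ?ys) \<subseteq> product_edges F E"
    using xs(1) unfolding e proper_walk_def product_edges_swap[of E F, symmetric] by auto
  moreover have "last (u # ?ys) = v"
    using xs(1) by (auto simp: proper_walk_def last_map prod_eq_iff split: if_splits)
  moreover have "map (\<lambda>e. c (prod.swap ` e)) (walk_edges u ?ys) = map c (walk_edges (prod.swap u) xs)"
    unfolding e by (simp add: image_image)
  moreover have "distinct (map prod.swap (prod.swap u # xs))"
    using xs(2) by (subst distinct_map) (auto intro: inj_onI)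
  ultimately show "\<exists>xs. proper_walk (\<lambda>e. c (prod.swap ` e)) (product_edges F E) u xs v \<and> distinct (u # xs)"
    using xs(1) by (intro exI[of _ ?ys]) (simp add: proper_walk_def)
qed

text \<open>In \<open>enat\<close> the product 0 * \<infinity> is 0, so a finite product has finite
  factors only when neither factor vanishes. Here zero colors would mean that there are no
  arcs.\<close>

lemma pc_nonzero:
  assumes "graph G" "connected G" "\<not> bipartite G"
  shows "pc G \<noteq> 0"
proof
  interpret graph G by fact
  assume "pc G = 0"
  then obtain c where "k_edge_coloring G 0 c" using pc_attained[of G 0] by (auto simp: zero_enat_def)
  then have "arcs G = {}" by (auto simp: k_edge_coloring_def)
  then show False using odd_part_nonempty[OF assms(2,3)] arcs_odd_part_subset[of G] by blast
qed

text \<open>With a sum of 0, \<open>proper_parity_coloring\<close> would give every edge a color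
  below 0.\<close>

lemma b_sum_o_sum_nonzero:
  assumes "graph G" "connected G" "\<not> bipartite G"
  shows "b_sum G + o_sum G \<noteq> 0"
proof
  interpret graph G by fact
  assume "b_sum G + o_sum G = 0"
  then obtain c :: "'a set \<Rightarrow> nat" where "\<forall>e\<in>edges_of G. c e < 0"
    using proper_parity_coloring[OF assms(2,3), of 0] by (auto simp: zero_enat_def)
  then have "arcs G = {}" by auto
  then show False using odd_part_nonempty[OF assms(2,3)] arcs_odd_part_subset[of G] by blast
qed

lemma product_coloring_exists:
  assumes "graph G" "connected G" "\<not> bipartite G" "graph H" "connected H" "\<not> bipartite H"
    and "pc H * (b_sum G + o_sum G) \<noteq> \<infinity>"
  obtains n c where "pc H * (b_sum G + o_sum G) = enat n"
    "\<forall>e\<in>product_edges (edges_of G) (edges_of H). c e < n"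
    "proper_connected_edges (verts G \<times> verts H) (product_edges (edges_of G) (edges_of H)) c"
proof -
  obtain k where k: "pc H = enat k"
    using assms(7) b_sum_o_sum_nonzero[OF assms(1-3)] by (cases "pc H") (auto simp: imult_is_infinity)
  obtain K where K: "b_sum G + o_sum G = enat K"
    using assms(7) pc_nonzero[OF assms(4-6)] by (cases "b_sum G + o_sum G") (auto simp: imult_is_infinity)
  show ?thesis using product_edges_coloring[OF assms(1-6) K k] that[of "k * K"] k K by auto
qed

theorem theorem3:
  fixes G :: "('a, 'b) pre_digraph" and H :: "('c, 'd) pre_digraph"
  assumes "graph G" and "connected G" and "\<not> bipartite G"
    and "graph H" and "connected H" and "\<not> bipartite H"
  shows "pc (direct_product G H) \<le>
    min (pc H * (b_sum G + o_sum G)) (pc G * (b_sum H + o_sum H))"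
proof (rule min.boundedI)
  let ?P = "direct_product G H"
  have P: "graph ?P" "verts ?P = verts G \<times> verts H"
    "edges_of ?P = product_edges (edges_of G) (edges_of H)"
    using graph_direct_product[OF assms(1,4)] edges_of_direct_product[OF assms(1,4)]
    by (simp_all add: direct_product_def)
  show "pc ?P \<le> pc H * (b_sum G + o_sum G)"
  proof (cases "pc H * (b_sum G + o_sum G) = \<infinity>")
    case False
    then show ?thesis
      using product_coloring_exists[OF assms] pc_le[OF P(1)] unfolding P by metis
  qed simp
  show "pc ?P \<le> pc G * (b_sum H + o_sum H)"
  proof (cases "pc G * (b_sum H + o_sum H) = \<infinity>")
    case False
    \<comment> \<open>The first bound is applied with the factors exchanged, and its coloring is
      pulled back along the swap of coordinates.\<close>
    then obtain n c where n: "pc G * (b_sum H + o_sum H) = enat n"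
      and c: "\<forall>e\<in>product_edges (edges_of H) (edges_of G). c e < n"
        "proper_connected_edges (verts H \<times> verts G) (product_edges (edges_of H) (edges_of G)) c"
      using product_coloring_exists[OF assms(4-6,1-3)] by blast
    have "\<forall>e\<in>product_edges (edges_of G) (edges_of H). c (prod.swap ` e) < n"
      using c(1) unfolding product_edges_swap[of "edges_of G" "edges_of H", symmetric] by blast
    moreover note proper_connected_edges_swap[OF c(2)]
    ultimately show ?thesis unfolding n by (intro pc_le[OF P(1)]) (simp_all add: P(2,3))
  qed simp
qed

end
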